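(* Let $\mathcal{A}$ be a separable nonunital $C^*$-algebra and $K$ an essential ideal in $\mathcal{A}$. Let $S$ be a closed semiregular operator on $\mathcal{A}$ such that its restriction $S|_K$ to $K$ is regular. If $\mathcal{A}/K$ is unital, then $S^{**}$ is regular.
   Context: A $C^*$-algebra $\mathcal{B}$ is regarded as a (right) Hilbert $\mathcal{B}$-module over itself with inner product $\langle a,b\rangle=a^*b$. An operator $T$ on $\mathcal{B}$ is a linear map with domain $D(T)\subseteq \mathcal{B}$ and values in $\mathcal{B}$; if $T$ is densely defined, its adjoint $T^*$ has domain $D(T^* )=\{a\in\mathcal{B}:\exists\, b\in\mathcal{B},\ \langle a,Tx\rangle=\langle b,x\rangle\ \forall x\in D(T)\}$ and $T^*a=b$. $T$ is closed (closable) if its graph is closed (the closure of its graph is a graph). $T$ is semiregular if (a) $D(T)$ is a dense right ideal of $\mathcal{B}$ (i.e. a dense submodule), (b) $T$ is closable, (c) $T^*$ is densely defined. $T$ is regular if it is closed and densely defined, $T^*$ is densely defined, and the range of $I+T^*T$ is dense in $\mathcal{B}$. The restriction $S|_K$ is the operator on $K$ (regarded as a Hilbert $K$-module) with domain $D(S)\cap K$, acting as $S$; for $S$ closed semiregular it takes values in $K$. *)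

theory Defs
  imports "HOL-Analysis.Analysis"
begin

text \<open>
  C*-algebras, not assumed to have a unit. The real scalar multiplication inherited from
  \<^class>\<open>banach\<close> is the restriction of the complex one.
\<close>

class cstar_algebra = real_normed_algebra + banach +
  fixes scaleC :: "complex \<Rightarrow> 'a \<Rightarrow> 'a" (infixr \<open>*\<^sub>C\<close> 75)
    and star :: "'a \<Rightarrow> 'a"
  assumes scaleC_add_right: "c *\<^sub>C (x + y) = c *\<^sub>C x + c *\<^sub>C y"
    and scaleC_add_left: "(c + d) *\<^sub>C x = c *\<^sub>C x + d *\<^sub>C x"
    and scaleC_scaleC: "c *\<^sub>C d *\<^sub>C x = (c * d) *\<^sub>C x"
    and scaleR_eq_scaleC: "r *\<^sub>R x = complex_of_real r *\<^sub>C x"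
    and norm_scaleC: "norm (c *\<^sub>C x) = cmod c * norm x"
    and mult_scaleC_left: "(c *\<^sub>C x) * y = c *\<^sub>C (x * y)"
    and mult_scaleC_right: "x * (c *\<^sub>C y) = c *\<^sub>C (x * y)"
    and star_add: "star (x + y) = star x + star y"
    and star_scaleC: "star (c *\<^sub>C x) = cnj c *\<^sub>C star x"
    and star_mult: "star (x * y) = star y * star x"
    and star_star: "star (star x) = x"
    and cstar_identity: "norm (star x * x) = (norm x)\<^sup>2"

definition csubspace :: "'a::cstar_algebra set \<Rightarrow> bool" where
  "csubspace V \<longleftrightarrow>
     0 \<in> V \<and> (\<forall>x\<in>V. \<forall>y\<in>V. x + y \<in> V) \<and> (\<forall>c. \<forall>x\<in>V. c *\<^sub>C x \<in> V)"

text \<open>As usual for C*-algebras, an ideal without qualification is closed and two-sided.\<close>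

definition cstar_ideal :: "'a::cstar_algebra set \<Rightarrow> bool" where
  "cstar_ideal J \<longleftrightarrow>
     csubspace J \<and> (\<forall>x\<in>J. \<forall>a. a * x \<in> J \<and> x * a \<in> J) \<and> closed J"

definition essential_ideal :: "'a::cstar_algebra set \<Rightarrow> bool" where
  "essential_ideal K \<longleftrightarrow>
     cstar_ideal K \<and> (\<forall>J. cstar_ideal J \<and> J \<noteq> {0} \<longrightarrow> K \<inter> J \<noteq> {0})"

definition unital_on :: "'b set \<Rightarrow> ('b \<Rightarrow> 'b \<Rightarrow> 'b) \<Rightarrow> bool" where
  "unital_on X m \<longleftrightarrow> (\<exists>e\<in>X. \<forall>x\<in>X. m e x = x \<and> m x e = x)"

definition ideal_rel :: "'a::cstar_algebra set \<Rightarrow> ('a \<times> 'a) set" where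
  "ideal_rel K = {(x, y). x - y \<in> K}"

definition quotient_carrier :: "'a::cstar_algebra set \<Rightarrow> 'a set set" where
  "quotient_carrier K = UNIV // ideal_rel K"

text \<open>For an ideal \<open>K\<close>, the union below is the single coset of the products of representatives.\<close>

definition quotient_mult :: "'a::cstar_algebra set \<Rightarrow> 'a set \<Rightarrow> 'a set \<Rightarrow> 'a set" where
  "quotient_mult K X Y = (\<Union>x\<in>X. \<Union>y\<in>Y. ideal_rel K `` {x * y})"

definition cinner :: "'a::cstar_algebra \<Rightarrow> 'a \<Rightarrow> 'a" where
  "cinner a b = star a * b"

text \<open>
  Unbounded operators are partial maps, with domain \<^term>\<open>dom T\<close>. The set argument \<open>B\<close> of the
  notions below is the C*-algebra, regarded as a Hilbert module over itself, on which the operator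
  acts. It is a closed *-subalgebra of the ambient type: \<^term>\<open>UNIV\<close> for the ambient algebra
  itself, or one of its ideals. As \<open>B\<close> is closed, density and closedness relative to \<open>B\<close> can be
  expressed with closures in the ambient type.
\<close>

definition operator_on :: "'a::cstar_algebra set \<Rightarrow> ('a \<rightharpoonup> 'a) \<Rightarrow> bool" where
  "operator_on B T \<longleftrightarrow>
     dom T \<subseteq> B \<and> ran T \<subseteq> B \<and> csubspace (dom T) \<and>
     (\<forall>x\<in>dom T. \<forall>y\<in>dom T. the (T (x + y)) = the (T x) + the (T y)) \<and>
     (\<forall>c. \<forall>x\<in>dom T. the (T (c *\<^sub>C x)) = c *\<^sub>C the (T x))"

definition densely_defined_on :: "'a::cstar_algebra set \<Rightarrow> ('a \<rightharpoonup> 'a) \<Rightarrow> bool" where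
  "densely_defined_on B T \<longleftrightarrow> B \<subseteq> closure (dom T)"

definition closed_op :: "('a::cstar_algebra \<rightharpoonup> 'a) \<Rightarrow> bool" where
  "closed_op T \<longleftrightarrow> closed (Map.graph T)"

definition closable_op :: "('a::cstar_algebra \<rightharpoonup> 'a) \<Rightarrow> bool" where
  "closable_op T \<longleftrightarrow> single_valued (closure (Map.graph T))"

definition adjoint_rel :: "'a::cstar_algebra set \<Rightarrow> ('a \<rightharpoonup> 'a) \<Rightarrow> 'a \<Rightarrow> 'a \<Rightarrow> bool" where
  "adjoint_rel B T a b \<longleftrightarrow>
     a \<in> B \<and> b \<in> B \<and> (\<forall>x\<in>dom T. cinner a (the (T x)) = cinner b x)"

text \<open>The value \<open>b\<close> is unique, and the adjoint meaningful, only for densely defined \<open>T\<close>.\<close>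

definition op_adjoint :: "'a::cstar_algebra set \<Rightarrow> ('a \<rightharpoonup> 'a) \<Rightarrow> ('a \<rightharpoonup> 'a)" where
  "op_adjoint B T =
     (\<lambda>a. if \<exists>b. adjoint_rel B T a b then Some (THE b. adjoint_rel B T a b) else None)"

definition semiregular_on :: "'a::cstar_algebra set \<Rightarrow> ('a \<rightharpoonup> 'a) \<Rightarrow> bool" where
  "semiregular_on B T \<longleftrightarrow>
     operator_on B T \<and>
     (\<forall>x\<in>dom T. \<forall>b\<in>B. x * b \<in> dom T) \<and> densely_defined_on B T \<and>
     closable_op T \<and>
     densely_defined_on B (op_adjoint B T)"

definition regular_on :: "'a::cstar_algebra set \<Rightarrow> ('a \<rightharpoonup> 'a) \<Rightarrow> bool" where
  "regular_on B T \<longleftrightarrow>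
     operator_on B T \<and> closed_op T \<and> densely_defined_on B T \<and>
     densely_defined_on B (op_adjoint B T) \<and>
     B \<subseteq> closure {x + y | x y. (op_adjoint B T \<circ>\<^sub>m T) x = Some y}"

end

theory Submission
  imports Defs
begin

text \<open>
  It suffices that \<open>1 + S\<^sup>*S\<close> has dense range. Since the algebra modulo \<open>K\<close> has a unit \<open>e\<close>, the dense
  right ideals \<open>D(S)\<close> and \<open>D(S\<^sup>*)\<close> contain elements \<open>x\<close> and \<open>y\<close> congruent to \<open>e\<close> modulo \<open>K\<close>. Then
  \<open>S x - y (S x)\<close> lies in \<open>K\<close>, hence, \<open>t = S|\<^sub>K\<close> being regular, equals \<open>v + t t\<^sup>* v\<close> for some \<open>v\<close>.
  Correcting \<open>x\<close> to \<open>x' = x - t\<^sup>* v\<close> gives \<open>S x' = y (S x) + v\<close>, which lies in \<open>D(S\<^sup>*)\<close>, and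
  \<open>x' + S\<^sup>* S x' = x + (S\<^sup>* y) (S x)\<close>, which is congruent to \<open>e + (S x)\<^sup>* (S x)\<close> and so invertible
  modulo \<open>K\<close>. The closure of the range of \<open>1 + S\<^sup>*S\<close> also contains \<open>K\<close>, since \<open>t\<^sup>*\<close> is a restriction of
  \<open>S\<^sup>*\<close>; being a right ideal, it is everything.
\<close>

section \<open>Positivity in unital C*-algebras\<close>

lemma scaleC_one [simp]: "1 *\<^sub>C x = (x::'a::cstar_algebra)"
  using scaleR_eq_scaleC[of 1 x] by simp

lemma scaleC_zero_left [simp]: "0 *\<^sub>C x = (0::'a::cstar_algebra)"
  using scaleR_eq_scaleC[of 0 x] by simp

lemma scaleC_minus_one [simp]: "(-1) *\<^sub>C x = - (x::'a::cstar_algebra)"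
  using scaleR_eq_scaleC[of "-1" x] by simp

lemma scaleC_minus_left: "(- c) *\<^sub>C x = - (c *\<^sub>C (x::'a::cstar_algebra))"
  using scaleC_scaleC[of "-1" c x] by simp

lemma scaleC_minus_right: "c *\<^sub>C (- x) = - (c *\<^sub>C (x::'a::cstar_algebra))"
  using scaleC_scaleC[of c "-1" x] by (simp add: scaleC_minus_left)

lemma scaleC_diff_right: "c *\<^sub>C (x - y) = c *\<^sub>C x - c *\<^sub>C (y::'a::cstar_algebra)"
  using scaleC_add_right[of c x "- y"] by (simp add: scaleC_minus_right)

lemma scaleC_zero_right [simp]: "c *\<^sub>C 0 = (0::'a::cstar_algebra)"
  using scaleC_scaleC[of c 0 "0::'a"] by simp

lemma scaleC_scaleR: "c *\<^sub>C (r *\<^sub>R x) = r *\<^sub>R (c *\<^sub>C (x::'a::cstar_algebra))"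
  by (simp add: scaleR_eq_scaleC scaleC_scaleC mult.commute)

lemma star_scaleR: "star (r *\<^sub>R x) = r *\<^sub>R star (x::'a::cstar_algebra)"
  by (simp add: scaleR_eq_scaleC star_scaleC)

lemma star_zero [simp]: "star (0::'a::cstar_algebra) = 0"
  using star_scaleR[of 0 "0::'a"] by simp

lemma star_minus: "star (- x) = - star (x::'a::cstar_algebra)"
  using star_scaleR[of "-1" x] by simp

lemma star_diff: "star (x - y) = star x - star (y::'a::cstar_algebra)"
  using star_add[of x "- y"] by (simp add: star_minus)

lemma norm_star [simp]: "norm (star x) = norm (x::'a::cstar_algebra)"
proof -
  have le: "norm z \<le> norm (star z)" for z :: 'a
  proof (cases "z = 0")
    case False
    have "norm z * norm z \<le> norm (star z) * norm z"
      using norm_mult_ineq[of "star z" z] by (simp add: cstar_identity power2_eq_square)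
    then show ?thesis using False by simp
  qed simp
  show ?thesis using le[of x] le[of "star x"] by (simp add: star_star)
qed

lemma bounded_linear_star: "bounded_linear (star :: 'a::cstar_algebra \<Rightarrow> 'a)"
  by (rule bounded_linear_intro[of _ 1]) (simp_all add: star_add star_scaleR)

lemma star_mult_self_eq_0_iff: "star x * x = 0 \<longleftrightarrow> x = (0::'a::cstar_algebra)"
  using cstar_identity[of x] by auto

lemma star_one [simp]: "star 1 = (1::'a::{cstar_algebra, real_normed_algebra_1})"
  using star_mult[of "star (1::'a)" 1] by (simp add: star_star)

lemma norm_selfadjoint_mult_self:
  "star a = a \<Longrightarrow> norm (a * a) = (norm (a::'a::cstar_algebra))\<^sup>2"
  using cstar_identity[of a] by simp

section \<open>The binomial series and square roots of \<open>1 - k\<close>\<close>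

text \<open>The power series coefficients of \<open>sqrt (1 - x)\<close>.\<close>

definition half_binomial :: "nat \<Rightarrow> real" where
  "half_binomial n = (- 1) ^ n * ((1 / 2) gchoose n)"

lemma half_binomial_0 [simp]: "half_binomial 0 = 1"
  by (simp add: half_binomial_def)

text \<open>The right-hand sides are the coefficients of \<open>1 / sqrt (1 - x)\<close>, which are
  nonnegative, so the partial sums never become negative.\<close>

lemma half_binomial_partial_sum:
  "(\<Sum>n\<le>N. half_binomial n) = (- 1) ^ N * ((- 1 / 2) gchoose N)"
  using gbinomial_sum_lower_neg[of "1/2 :: real" N]
  by (simp add: half_binomial_def mult.commute)

lemma neg_half_gbinomial_nonneg: "(- 1) ^ N * ((- 1 / 2 :: real) gchoose N) \<ge> 0"
proof (induction N)
  case (Suc N)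
  have "(- 1 / 2 :: real) gchoose Suc N = ((- 1 / 2) gchoose N) * (- (1 / 2 + real N) / (real N + 1))"
    using gbinomial_mult_1[of "- 1/2 :: real" N] by (simp add: field_simps)
  then have "(- 1) ^ Suc N * ((- 1 / 2 :: real) gchoose Suc N)
      = (- 1) ^ N * ((- 1 / 2 :: real) gchoose N) * ((1 / 2 + real N) / (real N + 1))"
    by (simp only: power_Suc)
  then show ?case using Suc by simp
qed simp

lemma half_binomial_nonpos:
  assumes "n > 0" shows "half_binomial n \<le> 0"
proof -
  obtain m where n: "n = Suc m" using assms not0_implies_Suc by auto
  have "real (Suc m) * ((1/2 :: real) gchoose Suc m) = (1/2) * ((- 1/2) gchoose m)"
    using gbinomial_absorption[of m "1/2 :: real"] by simp
  then have "half_binomial n = - ((- 1) ^ m * ((- 1/2) gchoose m)) / (2 * real (Suc m))"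
    by (simp add: half_binomial_def n field_simps)
  also have "\<dots> \<le> 0"
    using neg_half_gbinomial_nonneg[of m] by (intro divide_nonpos_pos) auto
  finally show ?thesis .
qed

text \<open>All coefficients after the zeroth being nonpositive, the absolute sum is 1 minus a
  nonnegative partial sum. Hence the series converges absolutely even for
  \<open>norm k = 1\<close>.\<close>

lemma half_binomial_abs_partial_sum: "(\<Sum>n\<le>N. \<bar>half_binomial (Suc n)\<bar>) \<le> 1"
proof -
  have "(\<Sum>n\<le>N. \<bar>half_binomial (Suc n)\<bar>) = - (\<Sum>n\<le>N. half_binomial (Suc n))"
    using half_binomial_nonpos by (simp add: sum_negf[symmetric] abs_of_nonpos)
  also have "\<dots> = 1 - (\<Sum>n\<le>Suc N. half_binomial n)"
    by (subst sum.atMost_Suc_shift) simp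
  also have "\<dots> \<le> 1"
    unfolding half_binomial_partial_sum using neg_half_gbinomial_nonneg[of "Suc N"] by simp
  finally show ?thesis .
qed

lemma summable_half_binomial_Suc: "summable (\<lambda>n. \<bar>half_binomial (Suc n)\<bar>)"
  by (rule bounded_imp_summable[OF _ half_binomial_abs_partial_sum]) simp

text \<open>Vandermonde with \<open>1/2 + 1/2 = 1\<close>: the square of the series has the
  coefficients of \<open>1 - x\<close>.\<close>

lemma half_binomial_convolution:
  "(\<Sum>i\<le>n. half_binomial i * half_binomial (n - i)) = (- 1) ^ n * (1 gchoose n)"
proof -
  have "(\<Sum>i\<le>n. half_binomial i * half_binomial (n - i))
      = (\<Sum>i\<le>n. (- 1) ^ n * (((1/2) gchoose i) * ((1/2) gchoose (n - i))))"
    by (intro sum.cong refl) (simp add: half_binomial_def power_add[symmetric])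
  also have "\<dots> = (- 1) ^ n * ((1/2 + 1/2) gchoose n)"
    by (simp add: gbinomial_Vandermonde sum_distrib_left[symmetric] atMost_atLeast0)
  finally show ?thesis by simp
qed

text \<open>A bound of the form \<open>norm (1 - s) \<le> 1\<close> will make the root itself
  positive, by \<open>cpos_of_norm_le\<close>; the commutation clause stands in for functional
  calculus.\<close>

lemma sqrt_one_minus_exists:
  fixes k :: "'a::{cstar_algebra, real_normed_algebra_1}"
  assumes k: "star k = k" "norm k \<le> 1"
  obtains s where "star s = s" "s * s = 1 - k" "norm (1 - s) \<le> 1"
    "\<And>z. z * k = k * z \<Longrightarrow> z * s = s * z"
proof -
  define f where "f n = half_binomial n *\<^sub>R k ^ n" for n
  define s where "s = suminf f"
  have norm_f: "norm (f n) \<le> \<bar>half_binomial n\<bar>" for n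
  proof -
    have "norm (k ^ n) \<le> 1"
      using norm_power_ineq[of k n] power_le_one[of "norm k" n] k by simp
    then show ?thesis unfolding f_def by (simp add: mult_left_le)
  qed
  have "summable (\<lambda>n. \<bar>half_binomial n\<bar>)"
    using summable_half_binomial_Suc by (subst (asm) summable_Suc_iff)
  then have nf: "summable (\<lambda>n. norm (f n))"
    by (rule summable_comparison_test'[where N = 0]) (use norm_f in simp)
  then have sf: "summable f" by (rule summable_norm_cancel)
  have star_pow: "star (k ^ n) = k ^ n" for n
    by (induction n) (simp_all add: star_mult k power_commutes)
  have star_f: "star (f n) = f n" for n
    by (simp add: f_def star_scaleR star_pow)
  have "star s = (\<Sum>n. star (f n))"
    unfolding s_def by (rule bounded_linear.suminf[OF bounded_linear_star sf])
  also have "\<dots> = s" by (simp add: s_def star_f)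
  finally have 1: "star s = s" .
  have "(\<lambda>n. \<Sum>i\<le>n. f i * f (n - i)) sums (s * s)"
    unfolding s_def by (rule Cauchy_product_sums[OF nf nf])
  moreover have "(\<Sum>i\<le>n. f i * f (n - i)) = ((- 1) ^ n * (1 gchoose n)) *\<^sub>R k ^ n" for n
  proof -
    have "(\<Sum>i\<le>n. f i * f (n - i))
        = (\<Sum>i\<le>n. (half_binomial i * half_binomial (n - i)) *\<^sub>R k ^ n)"
      by (intro sum.cong refl) (simp add: f_def power_add[symmetric] mult.commute)
    also have "\<dots> = ((- 1) ^ n * (1 gchoose n)) *\<^sub>R k ^ n"
      by (simp add: scaleR_left.sum[symmetric] half_binomial_convolution)
    finally show ?thesis .
  qed
  ultimately have "(\<lambda>n. ((- 1) ^ n * (1 gchoose n)) *\<^sub>R k ^ n) sums (s * s)" by simp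
  moreover have "(\<lambda>n. ((- 1) ^ n * (1 gchoose n)) *\<^sub>R k ^ n) sums
      (\<Sum>n\<in>{0,1}. ((- 1) ^ n * (1 gchoose n)) *\<^sub>R k ^ n)"
  proof (rule sums_finite)
    fix n :: nat assume "n \<notin> {0,1}"
    then have "(1::nat) choose n = 0" by (simp add: binomial_eq_0)
    then have "(1::real) gchoose n = 0"
      using binomial_gbinomial[of 1 n, where 'a = real] by (metis of_nat_0 of_nat_1)
    then show "((- 1) ^ n * (1 gchoose n)) *\<^sub>R k ^ n = 0" by simp
  qed simp
  ultimately have 2: "s * s = 1 - k" by (simp add: sums_unique2)
  have "1 - s = - (\<Sum>n. f (Suc n))"
    using suminf_split_head[OF sf] by (simp add: s_def f_def)
  then have "norm (1 - s) = norm (\<Sum>n. f (Suc n))" by simp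
  also have "\<dots> \<le> (\<Sum>n. \<bar>half_binomial (Suc n)\<bar>)"
    by (rule norm_suminf_le[OF norm_f summable_half_binomial_Suc])
  also have "\<dots> \<le> 1"
  proof (rule suminf_le_const[OF summable_half_binomial_Suc])
    fix n show "(\<Sum>i<n. \<bar>half_binomial (Suc i)\<bar>) \<le> 1"
      using half_binomial_abs_partial_sum by (cases n) (auto simp: lessThan_Suc_atMost)
  qed
  finally have 3: "norm (1 - s) \<le> 1" .
  have 4: "z * s = s * z" if zk: "z * k = k * z" for z
  proof -
    have "z * k ^ n = k ^ n * z" for n
      using zk by (rule power_commuting_commutes[symmetric, OF sym])
    then show ?thesis
      using suminf_mult[OF sf, of z] suminf_mult2[OF sf, of z]
      by (simp add: s_def f_def)
  qed
  show thesis by (rule that[OF 1 2 3 4])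
qed

section \<open>Positive elements and their norms\<close>

lemma norm_le_of_squares_sum:
  fixes a b :: "'a::{cstar_algebra, real_normed_algebra_1}"
  assumes a: "star a = a" and b: "star b = b" and ab: "a * b = b * a"
    and sum: "a * a + b * b = s *\<^sub>R 1" and s: "s \<ge> 0"
  shows "norm (a * a) \<le> s"
proof -
  \<comment> \<open>Since \<open>a\<close> and \<open>b\<close> commute, the cross terms of
    \<open>star u * u\<close> cancel and \<open>norm u\<close> is the square root of
    \<open>s\<close>. As \<open>a\<close> is the real part of \<open>u\<close>, its norm is no
    larger. This replaces a spectral argument.\<close>
  define u where "u = a + \<i> *\<^sub>C b"
  have su: "star u = a - \<i> *\<^sub>C b"
    by (simp add: u_def star_add star_scaleC a b scaleC_minus_left)
  have "star u * u = a * a + b * b"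
    unfolding su by (simp add: u_def algebra_simps mult_scaleC_left mult_scaleC_right
        scaleC_scaleC scaleC_minus_left scaleC_diff_right scaleC_add_right ab)
  then have "(norm u)\<^sup>2 = s" using cstar_identity[of u] s by (simp add: sum)
  have "2 *\<^sub>R a = u + star u" unfolding su by (simp add: u_def scaleR_2)
  then have "2 * norm a \<le> norm u + norm (star u)"
    using norm_triangle_ineq[of u "star u"] by (metis norm_scaleR abs_numeral)
  then have "norm a \<le> norm u" by simp
  then have "(norm a)\<^sup>2 \<le> s"
    using \<open>(norm u)\<^sup>2 = s\<close> by (metis norm_ge_zero power_mono)
  then show ?thesis using norm_selfadjoint_mult_self[OF a] by simp
qed

text \<open>Encoding positivity by a self-adjoint square root avoids the spectrum. In a unital
  algebra \<open>cpos_of_norm_le\<close> and \<open>cpos_norm_le\<close> tie it to the norm, and the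
  order properties come from that criterion.\<close>

definition cpos :: "'a::cstar_algebra \<Rightarrow> bool" where
  "cpos h \<longleftrightarrow> (\<exists>c. star c = c \<and> h = c * c)"

lemma cpos_selfadjoint: "cpos h \<Longrightarrow> star h = h"
  by (auto simp: cpos_def star_mult)

lemma cpos_scaleR:
  assumes "cpos h" "r \<ge> 0" shows "cpos (r *\<^sub>R h)"
proof -
  obtain c where "star c = c" "h = c * c" using assms by (auto simp: cpos_def)
  then show ?thesis unfolding cpos_def
    using assms(2) by (intro exI[of _ "sqrt r *\<^sub>R c"]) (simp add: star_scaleR)
qed

lemma cpos_sqrt_of_norm_le:
  fixes h :: "'a::{cstar_algebra, real_normed_algebra_1}"
  assumes h: "star h = h" "norm (t *\<^sub>R 1 - h) \<le> t"
  obtains c where "star c = c" "c * c = h" "norm (sqrt t *\<^sub>R 1 - c) \<le> sqrt t"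
    "\<And>z. z * h = h * z \<Longrightarrow> z * c = c * z"
proof (cases "t = 0")
  case True
  then have "h = 0" using h by simp
  show thesis by (rule that[of 0]) (auto simp: \<open>h = 0\<close> True)
next
  case False
  then have t: "t > 0" using h(2) norm_ge_zero[of "t *\<^sub>R 1 - h"] by linarith
  define k where "k = 1 - (1 / t) *\<^sub>R h"
  have h_eq: "h = t *\<^sub>R (1 - k)" using t by (simp add: k_def)
  have "k = (1 / t) *\<^sub>R (t *\<^sub>R 1 - h)" using t by (simp add: k_def algebra_simps)
  then have "norm k \<le> 1" using t h(2) by simp
  moreover have "star k = k" by (simp add: k_def star_diff star_scaleR h)
  ultimately obtain s where s: "star s = s" "s * s = 1 - k" "norm (1 - s) \<le> 1"
    and com: "\<And>z. z * k = k * z \<Longrightarrow> z * s = s * z"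
    using sqrt_one_minus_exists by blast
  show thesis
  proof (rule that[of "sqrt t *\<^sub>R s"])
    show "star (sqrt t *\<^sub>R s) = sqrt t *\<^sub>R s" by (simp add: star_scaleR s)
    show "sqrt t *\<^sub>R s * sqrt t *\<^sub>R s = h" using t by (simp add: s h_eq)
    have "sqrt t *\<^sub>R 1 - sqrt t *\<^sub>R s = sqrt t *\<^sub>R (1 - s)" by (simp add: algebra_simps)
    then show "norm (sqrt t *\<^sub>R 1 - sqrt t *\<^sub>R s) \<le> sqrt t"
      using s(3) t by (simp add: mult_left_le)
    fix z assume "z * h = h * z"
    then have "z * k = k * z" by (simp add: k_def algebra_simps)
    then show "z * sqrt t *\<^sub>R s = sqrt t *\<^sub>R s * z" using com by simp
  qed
qed

lemma cpos_of_norm_le: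
  fixes h :: "'a::{cstar_algebra, real_normed_algebra_1}"
  assumes "star h = h" "norm (t *\<^sub>R 1 - h) \<le> t"
  shows "cpos h"
  using cpos_sqrt_of_norm_le[OF assms] unfolding cpos_def by metis

text \<open>As \<open>norm h \<le> t\<close>, the element \<open>t *\<^sub>R 1 - h\<close> has a
  root \<open>d\<close>, which commutes with the root \<open>c\<close> of \<open>h\<close>; then
  \<open>c * c + d * d\<close> is the scalar \<open>t\<close> and
  \<open>norm_le_of_squares_sum\<close> bounds \<open>d * d\<close>.\<close>

lemma cpos_norm_le:
  fixes h :: "'a::{cstar_algebra, real_normed_algebra_1}"
  assumes "cpos h" and t: "norm h \<le> t"
  shows "norm (t *\<^sub>R 1 - h) \<le> t"
proof -
  obtain c where c: "star c = c" "h = c * c" using assms by (auto simp: cpos_def)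
  have "norm (t *\<^sub>R 1 - (t *\<^sub>R 1 - h)) \<le> t" using t by simp
  moreover have "star (t *\<^sub>R 1 - h) = t *\<^sub>R 1 - h"
    using cpos_selfadjoint[OF assms(1)] by (simp add: star_diff star_scaleR)
  ultimately obtain d where d: "star d = d" "d * d = t *\<^sub>R 1 - h"
    and com: "\<And>z. z * (t *\<^sub>R 1 - h) = (t *\<^sub>R 1 - h) * z \<Longrightarrow> z * d = d * z"
    using cpos_sqrt_of_norm_le by metis
  have "c * d = d * c"
    by (rule com) (simp add: c algebra_simps)
  then have "norm (d * d) \<le> t"
    using order_trans[OF norm_ge_zero t] by (intro norm_le_of_squares_sum[of d c]) (auto simp: c d)
  then show ?thesis by (simp add: d)
qed

lemma cpos_sqrt:
  fixes h :: "'a::{cstar_algebra, real_normed_algebra_1}"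
  assumes "cpos h"
  obtains c where "cpos c" "c * c = h" "\<And>z. z * h = h * z \<Longrightarrow> z * c = c * z"
  using cpos_sqrt_of_norm_le[OF cpos_selfadjoint[OF assms] cpos_norm_le[OF assms order_refl]]
    cpos_of_norm_le by metis

text \<open>Squares are not visibly closed under addition, but the norm criterion is: the two bounds
  add up by the triangle inequality.\<close>

lemma cpos_add:
  fixes h k :: "'a::{cstar_algebra, real_normed_algebra_1}"
  assumes "cpos h" "cpos k"
  shows "cpos (h + k)"
proof (rule cpos_of_norm_le)
  show "star (h + k) = h + k" using assms by (simp add: star_add cpos_selfadjoint)
  have "norm ((norm h *\<^sub>R 1 - h) + (norm k *\<^sub>R 1 - k)) \<le> norm h + norm k"
    by (intro norm_triangle_mono cpos_norm_le assms order_refl)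
  then show "norm ((norm h + norm k) *\<^sub>R 1 - (h + k)) \<le> norm h + norm k"
    by (simp add: algebra_simps)
qed

lemma cpos_norm_le_of_diff:
  fixes h :: "'a::{cstar_algebra, real_normed_algebra_1}"
  assumes "cpos h" "cpos (s *\<^sub>R 1 - h)" "s \<ge> 0"
  shows "norm h \<le> s"
proof -
  obtain c where c: "cpos c" "c * c = h" using cpos_sqrt[OF assms(1)] by metis
  obtain d where d: "cpos d" "d * d = s *\<^sub>R 1 - h"
    and com: "\<And>z. z * (s *\<^sub>R 1 - h) = (s *\<^sub>R 1 - h) * z \<Longrightarrow> z * d = d * z"
    using cpos_sqrt[OF assms(2)] by metis
  have "c * d = d * c" by (rule com) (simp add: c(2)[symmetric] algebra_simps)
  then have "norm (c * c) \<le> s"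
    using assms(3) by (intro norm_le_of_squares_sum[of c d]) (auto simp: c d cpos_selfadjoint)
  then show ?thesis by (simp add: c)
qed

text \<open>Split \<open>norm (h + k) *\<^sub>R 1 - h\<close> into
  \<open>norm (h + k) *\<^sub>R 1 - (h + k)\<close>, positive by the norm criterion, and
  \<open>k\<close>.\<close>

lemma cpos_norm_mono:
  fixes h k :: "'a::{cstar_algebra, real_normed_algebra_1}"
  assumes "cpos h" "cpos k"
  shows "norm h \<le> norm (h + k)"
proof (rule cpos_norm_le_of_diff[OF assms(1)])
  have "cpos (norm (h + k) *\<^sub>R 1 - (h + k))"
    using assms by (intro cpos_of_norm_le[where t = "norm (h + k)"])
      (simp_all add: star_diff star_scaleR star_add cpos_selfadjoint add.commute)
  then have "cpos (norm (h + k) *\<^sub>R 1 - (h + k) + k)" using assms(2) by (rule cpos_add)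
  then show "cpos (norm (h + k) *\<^sub>R 1 - h)" by simp
qed simp

text \<open>With \<open>t = norm k\<close>, positivity gives
  \<open>norm (t *\<^sub>R 1 - k) \<le> t\<close>, so \<open>(1 + t) *\<^sub>R w\<close> differs
  from \<open>w + k * w\<close> by at most \<open>t * norm w\<close>. Thus \<open>1 + k\<close> is
  bounded below before anything is known about its inverse.\<close>

lemma norm_le_norm_one_plus_cpos_mult:
  fixes k w :: "'a::{cstar_algebra, real_normed_algebra_1}"
  assumes "cpos k"
  shows "norm w \<le> norm (w + k * w)"
proof -
  let ?t = "norm k"
  have "(1 + ?t) *\<^sub>R w = (w + k * w) + (?t *\<^sub>R 1 - k) * w" by (simp add: algebra_simps)
  then have "(1 + ?t) * norm w = norm ((w + k * w) + (?t *\<^sub>R 1 - k) * w)"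
    by (metis abs_of_nonneg add_nonneg_nonneg norm_ge_zero norm_scaleR zero_le_one)
  also have "\<dots> \<le> norm (w + k * w) + norm (?t *\<^sub>R 1 - k) * norm w"
    using norm_triangle_ineq norm_mult_ineq by (metis add_left_mono order_trans)
  also have "\<dots> \<le> norm (w + k * w) + ?t * norm w"
    using cpos_norm_le[OF assms order_refl] by (simp add: mult_right_mono)
  finally show ?thesis by (simp add: algebra_simps)
qed

section \<open>Positivity of \<open>star x * x\<close>\<close>

text \<open>
  With \<open>q = - y\<^sup>* y\<close> of norm one and \<open>k = y y\<^sup>*\<close>, the identity \<open>(1 + k) (y q) = y (q - q\<^sup>2)\<close>
  bounds \<open>norm (y q)\<close> by \<open>norm (q - q\<^sup>2) \<le> 1 / 4\<close>, whereas \<open>(norm (y q))\<^sup>2 = norm (q\<^sup>3) = 1\<close>.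
\<close>

lemma neg_star_mult_self_cpos_imp_zero:
  fixes y :: "'a::{cstar_algebra, real_normed_algebra_1}"
  assumes "cpos (- (star y * y))"
  shows "y = 0"
proof (rule ccontr)
  assume "y \<noteq> 0"
  define x where "x = (1 / norm y) *\<^sub>R y"
  have nx: "norm x = 1" using \<open>y \<noteq> 0\<close> by (simp add: x_def)
  define q where "q = - (star x * x)"
  define k where "k = x * star x"
  have "q = (1 / norm y)\<^sup>2 *\<^sub>R (- (star y * y))"
    by (simp add: q_def x_def star_scaleR power2_eq_square)
  then have q: "cpos q" using cpos_scaleR[OF assms] by simp
  have nq: "norm q = 1" using cstar_identity[of x] nx by (simp add: q_def)
  \<comment> \<open>Here \<open>x = a - i b\<close>, and \<open>x * star x + star x * x\<close> is
    twice \<open>a * a + b * b\<close>. As \<open>q\<close> is minus the second product,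
    \<open>k\<close> becomes a sum of three positive elements.\<close>
  define a where "a = (1/2) *\<^sub>R (x + star x)"
  define b where "b = (1/2) *\<^sub>R (\<i> *\<^sub>C (x - star x))"
  have sa: "star a = a" by (simp add: a_def star_scaleR star_add star_star add.commute)
  have sb: "star b = b"
    by (simp add: b_def star_scaleR star_scaleC star_diff star_star scaleC_minus_left
        scaleC_minus_right[symmetric])
  have "a * a + b * b = (1/4) *\<^sub>R ((x + star x) * (x + star x) - (x - star x) * (x - star x))"
    by (simp add: a_def b_def mult_scaleC_left mult_scaleC_right scaleC_scaleC scaleC_minus_left
        scaleC_scaleR scaleR_diff_right)
  also have "\<dots> = (1/4) *\<^sub>R (2 *\<^sub>R (x * star x + star x * x))"
    by (simp add: algebra_simps scaleR_2)
  finally have "2 *\<^sub>R (a * a + b * b) = x * star x + star x * x" by simp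
  then have k: "k = 2 *\<^sub>R (a * a) + 2 *\<^sub>R (b * b) + q"
    by (simp only: scaleR_add_right[symmetric]) (simp add: k_def q_def)
  have "cpos k" unfolding k
    using sa sb q by (intro cpos_add cpos_scaleR) (auto simp: cpos_def)
  obtain c where c: "cpos c" "c * c = q"
    using cpos_sqrt[OF q] by metis
  have "cpos (1 - q)"
    by (rule cpos_of_norm_le[where t = 1]) (simp_all add: star_diff cpos_selfadjoint q nq)
  then obtain d where d: "cpos d" "d * d = 1 - q"
    and comd: "\<And>z. z * (1 - q) = (1 - q) * z \<Longrightarrow> z * d = d * z"
    using cpos_sqrt by metis
  have cd: "c * d = d * c" by (rule comd) (simp add: c(2)[symmetric] algebra_simps)
  have qd: "q * d = d * q" by (rule comd) (simp add: algebra_simps)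
  \<comment> \<open>Since \<open>p * p = 4 (q - q * q)\<close>, the squares of \<open>p\<close> and
    \<open>1 - 2 q\<close> add up to 1. This yields the bound 1/4, the maximum of
    \<open>s - s * s\<close> on the unit interval, without functional calculus.\<close>
  define p where "p = 2 *\<^sub>R (c * d)"
  have "c * d * (c * d) = c * (d * c) * d" by (simp add: mult.assoc)
  also have "\<dots> = c * c * (d * d)" by (simp only: cd[symmetric] mult.assoc)
  finally have cdcd: "c * d * (c * d) = q - q * q" by (simp add: c d algebra_simps)
  have "norm (p * p) \<le> 1"
  proof (rule norm_le_of_squares_sum)
    show "star p = p" by (simp add: p_def star_scaleR star_mult cpos_selfadjoint c d cd)
    show "star (1 - 2 *\<^sub>R q) = 1 - 2 *\<^sub>R q"
      by (simp add: star_diff star_scaleR cpos_selfadjoint q)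
    have "q * (c * d) = c * d * q" using c(2) cd qd by (metis mult.assoc)
    then show "p * (1 - 2 *\<^sub>R q) = (1 - 2 *\<^sub>R q) * p" by (simp add: p_def algebra_simps)
    have "p * p = 4 *\<^sub>R (q - q * q)" by (simp add: p_def cdcd)
    then show "p * p + (1 - 2 *\<^sub>R q) * (1 - 2 *\<^sub>R q) = 1 *\<^sub>R 1"
      by (simp add: algebra_simps scaleR_left_distrib[of 2 2, simplified])
  qed simp
  then have qq: "norm (q - q * q) \<le> 1/4" by (simp add: p_def cdcd)
  have "x * (q - q * q) = x * q + k * (x * q)"
    by (simp add: k_def q_def algebra_simps)
  then have "norm (x * q) \<le> norm (x * (q - q * q))"
    using norm_le_norm_one_plus_cpos_mult[OF \<open>cpos k\<close>, of "x * q"] by simp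
  also have "\<dots> \<le> 1/4" using norm_mult_ineq[of x "q - q * q"] nx qq by simp
  finally have "norm (x * q) \<le> 1/4" .
  then have "(norm (x * q))\<^sup>2 \<le> (1/4)\<^sup>2" by (intro power_mono) auto
  moreover have "star (x * q) * (x * q) = - (q * q * q)"
    using cpos_selfadjoint[OF q] by (simp add: star_mult) (simp add: q_def mult.assoc)
  ultimately have "norm (q * q * q) \<le> 1/16"
    using cstar_identity[of "x * q"] by (simp add: power2_eq_square)
  \<comment> \<open>One more factor \<open>q\<close> produces the fourth power, whose norm is
    exactly 1 by applying the C*-identity twice.\<close>
  then have "norm (q * q * q * q) \<le> 1/16" using norm_mult_ineq[of "q * q * q" q] nq by simp
  moreover have "norm (q * q * (q * q)) = 1"
    using norm_selfadjoint_mult_self[of q] norm_selfadjoint_mult_self[of "q * q"]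
    by (simp add: star_mult cpos_selfadjoint q nq)
  ultimately show False by (simp add: mult.assoc)
qed

text \<open>
  With \<open>h = x\<^sup>* x\<close>, \<open>s = \<bar>h\<bar>\<close> and \<open>y = x (s - h)\<close>, the element \<open>- y\<^sup>* y = s (s - h)\<^sup>2\<close> is a square.
\<close>

lemma cpos_star_mult_self:
  fixes x :: "'a::{cstar_algebra, real_normed_algebra_1}"
  shows "cpos (star x * x)"
proof -
  define h where "h = star x * x"
  have sh: "star h = h" by (simp add: h_def star_mult star_star)
  then have "cpos (h * h)" by (auto simp: cpos_def)
  then obtain s where s: "cpos s" "s * s = h * h" and "\<And>z. z * (h * h) = h * h * z \<Longrightarrow> z * s = s * z"
    using cpos_sqrt by metis
  then have hs: "h * s = s * h" by (simp add: mult.assoc)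
  \<comment> \<open>A root of \<open>s\<close> is needed to exhibit
    \<open>s * (s - h) * (s - h)\<close> as the square of the self-adjoint \<open>w\<close>.\<close>
  obtain m where m: "cpos m" "m * m = s" and com: "\<And>z. z * s = s * z \<Longrightarrow> z * m = m * z"
    using cpos_sqrt[OF s(1)] by metis
  have ms: "s * m = m * s" by (rule com) simp
  have mh: "h * m = m * h" using com hs by simp
  define y where "y = x * (s - h)"
  define w where "w = m * (s - h)"
  have sw: "star w = w"
    by (simp add: w_def star_mult star_diff sh cpos_selfadjoint s m algebra_simps ms mh)
  have sy: "star y = (s - h) * star x"
    by (simp add: y_def star_mult star_diff sh cpos_selfadjoint s)
  have "star y * y = (s - h) * (h * (s - h))" unfolding sy by (simp add: y_def h_def mult.assoc)
  also have "h * (s - h) = - (s * (s - h))"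
    by (simp add: algebra_simps s hs)
  also have "(s - h) * (- (s * (s - h))) = - ((s - h) * m * (m * (s - h)))"
    by (simp add: m(2)[symmetric] mult.assoc)
  also have "(s - h) * m = w" by (simp add: w_def algebra_simps ms mh)
  finally have yy: "- (star y * y) = w * w" by (simp add: w_def)
  then have "cpos (- (star y * y))" using sw by (auto simp: cpos_def)
  then have "y = 0" by (rule neg_star_mult_self_cpos_imp_zero)
  then have "star w * w = 0" using yy sw by simp
  then have "w = 0" by (simp only: star_mult_self_eq_0_iff)
  then have "m * w = 0" by simp
  \<comment> \<open>Together with \<open>s * s = h * h\<close> this makes
    \<open>(s - h) * (s - h)\<close> vanish, so \<open>h\<close> equals the positive
    \<open>s\<close>.\<close>
  then have "s * (s - h) = 0" by (simp add: w_def m(2)[symmetric] mult.assoc)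
  then have "s * h = h * h" by (simp add: algebra_simps s)
  then have "(s - h) * (s - h) = 0" by (simp add: algebra_simps s hs)
  then have "star (s - h) * (s - h) = 0" by (simp add: star_diff sh cpos_selfadjoint s)
  then have "s - h = 0" by (simp only: star_mult_self_eq_0_iff)
  then show ?thesis using s(1) by (simp add: h_def)
qed

section \<open>Unitization\<close>

datatype 'a unitization = Unitization (base: 'a) (scal: complex)

lemma unitization_eq_iff: "u = v \<longleftrightarrow> base u = base v \<and> scal u = scal v"
  by (auto intro: unitization.expand)

lemma scaleC_scaleR_left: "(r *\<^sub>R c) *\<^sub>C x = r *\<^sub>R (c *\<^sub>C (x::'a::cstar_algebra))"
  by (simp add: scaleR_eq_scaleC scaleC_scaleC scaleR_conv_of_real)

instantiation unitization :: (cstar_algebra) real_algebra_1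
begin

definition "0 = Unitization 0 0"
definition "1 = Unitization 0 1"
definition "u + v = Unitization (base u + base v) (scal u + scal v)"
definition "- u = Unitization (- base u) (- scal u)"
definition "u - v = Unitization (base u - base v) (scal u - scal v)"
definition "u * v = Unitization (base u * base v + scal u *\<^sub>C base v + scal v *\<^sub>C base u) (scal u * scal v)"
definition "r *\<^sub>R u = Unitization (r *\<^sub>R base u) (r *\<^sub>R scal u)"

lemmas unitization_ops_defs = zero_unitization_def one_unitization_def plus_unitization_def
  uminus_unitization_def minus_unitization_def times_unitization_def scaleR_unitization_def

instance
  by standard
    (simp_all add: unitization_ops_defs unitization_eq_iff algebra_simps scaleC_add_left
      scaleC_add_right scaleC_scaleC mult_scaleC_left mult_scaleC_right scaleC_scaleR scaleC_scaleR_left)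

end

lemma unitization_ops [simp]:
  "base (0::'a unitization) = 0" "scal (0::'a unitization) = 0"
  "base (1::'a unitization) = 0" "scal (1::'a unitization) = 1"
  "base (u + v) = base u + base v" "scal (u + v) = scal u + scal v"
  "base (- u) = - base u" "scal (- u) = - scal u"
  "base (u - v) = base u - base v" "scal (u - v) = scal u - scal v"
  "base (u * v) = base u * base v + scal u *\<^sub>C base v + scal v *\<^sub>C base u"
  "scal (u * v) = scal u * scal v"
  "base (r *\<^sub>R u) = r *\<^sub>R base u" "scal (r *\<^sub>R u) = r *\<^sub>R scal u"
  for u v :: "'a::cstar_algebra unitization"
  by (simp_all add: unitization_ops_defs)

text \<open>The operator norm of this action leads to the C*-identity on the unitization, which the
  norm \<open>norm (base u) + cmod (scal u)\<close> does not satisfy in general.\<close>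

definition left_action :: "'a::cstar_algebra unitization \<Rightarrow> 'a \<Rightarrow> 'a" where
  "left_action u x = base u * x + scal u *\<^sub>C x"

lemma bounded_linear_scaleC: "bounded_linear (\<lambda>x::'a::cstar_algebra. c *\<^sub>C x)"
  by (rule bounded_linear_intro[of _ "cmod c"])
    (simp_all add: scaleC_add_right scaleC_scaleR norm_scaleC mult.commute)

lemma bounded_linear_left_action: "bounded_linear (left_action u)"
  unfolding left_action_def
  by (intro bounded_linear_add bounded_linear_mult_right bounded_linear_scaleC)

lemma left_action_mult: "left_action (u * v) x = left_action u (left_action v x)"
  by (simp add: left_action_def algebra_simps scaleC_add_right scaleC_scaleC
      mult_scaleC_left mult_scaleC_right)

text \<open>The lower bound is tested at \<open>star a\<close>, by the C*-identity. It makes the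
  embedding into the unitization isometric.\<close>

lemma onorm_left_action_embed: "onorm (left_action (Unitization a 0)) = norm a"
proof (rule antisym)
  show "onorm (left_action (Unitization a 0)) \<le> norm a"
    by (rule onorm_bound) (simp_all add: left_action_def norm_mult_ineq)
  show "norm a \<le> onorm (left_action (Unitization a 0))"
  proof (cases "a = 0")
    case True
    then show ?thesis using onorm_pos_le[OF bounded_linear_left_action] by simp
  next
    case False
    have "norm (a * star a) = norm a * norm a"
      using cstar_identity[of "star a"] by (simp add: star_star power2_eq_square)
    then have "norm a * norm a \<le> onorm (left_action (Unitization a 0)) * norm a"
      using onorm[OF bounded_linear_left_action, of "Unitization a 0" "star a"]
      by (simp add: left_action_def)
    then show ?thesis using False by simp
  qed
qed

instantiation unitization :: (cstar_algebra) real_normed_algebra_1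
begin

text \<open>
  The second entry of the maximum makes this a norm even if the algebra already has a unit.
\<close>

definition norm_unitization_def:
  "norm (u::'a unitization) = max (onorm (left_action u)) (cmod (scal u))"
definition sgn_unitization_def:
  "sgn (u::'a unitization) = inverse (norm u) *\<^sub>R u"
definition dist_unitization_def:
  "dist (u::'a unitization) v = norm (u - v)"
definition uniformity_unitization_def:
  "(uniformity :: ('a unitization \<times> 'a unitization) filter) = (INF e\<in>{0<..}. principal {(x, y). dist x (y::'a unitization) < e})"
definition open_unitization_def:
  "open (U :: 'a unitization set) \<longleftrightarrow> (\<forall>x\<in>U. \<forall>\<^sub>F (x', y) in uniformity. x' = x \<longrightarrow> y \<in> (U::'a unitization set))"

instance
proof
  fix u v :: "'a unitization" and r :: real
  note bl = bounded_linear_left_action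
  show "norm u = 0 \<longleftrightarrow> u = 0"
  proof
    assume nu: "norm u = 0"
    have "0 \<le> onorm (left_action u)" by (rule onorm_pos_le[OF bl])
    then have o: "onorm (left_action u) = 0" and s: "scal u = 0"
      using nu norm_ge_zero[of "scal u"] by (simp_all add: norm_unitization_def max_def split: if_splits)
    have "u = Unitization (base u) 0" by (simp add: unitization_eq_iff s)
    then have "norm (base u) = 0" using o onorm_left_action_embed[of "base u"] by simp
    then show "u = 0" by (simp add: unitization_eq_iff s)
  next
    assume "u = 0"
    moreover have "left_action (0::'a unitization) = (\<lambda>x. 0)" by (simp add: left_action_def fun_eq_iff)
    ultimately show "norm u = 0" by (simp add: norm_unitization_def onorm_zero)
  qed
  have "left_action (u + v) = (\<lambda>x. left_action u x + left_action v x)"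
    by (simp add: left_action_def fun_eq_iff scaleC_add_left algebra_simps)
  then have "onorm (left_action (u + v)) \<le> onorm (left_action u) + onorm (left_action v)"
    using onorm_triangle[OF bl bl] by simp
  then show "norm (u + v) \<le> norm u + norm v"
    using norm_triangle_ineq[of "scal u" "scal v"]
    by (simp add: norm_unitization_def) linarith
  have "left_action (r *\<^sub>R u) = (\<lambda>x. r *\<^sub>R left_action u x)"
    by (simp add: left_action_def fun_eq_iff scaleR_add_right scaleC_scaleR_left)
  then show "norm (r *\<^sub>R u) = \<bar>r\<bar> * norm u"
    by (simp add: norm_unitization_def onorm_scaleR[OF bl] max_mult_distrib_left)
  have "left_action (u * v) = left_action u \<circ> left_action v"
    by (simp add: fun_eq_iff left_action_mult)
  then have "onorm (left_action (u * v)) \<le> onorm (left_action u) * onorm (left_action v)"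
    using onorm_compose[OF bl bl] by metis
  also have "\<dots> \<le> norm u * norm v"
    by (intro mult_mono) (auto simp: norm_unitization_def onorm_pos_le[OF bl] le_max_iff_disj)
  finally show "norm (u * v) \<le> norm u * norm v"
    by (auto simp: norm_unitization_def norm_mult le_max_iff_disj intro!: mult_mono)
  have "onorm (left_action (1::'a unitization)) \<le> 1"
    by (rule onorm_bound) (simp_all add: left_action_def)
  then show "norm (1::'a unitization) = 1" by (simp add: norm_unitization_def)
qed (fact sgn_unitization_def dist_unitization_def uniformity_unitization_def open_unitization_def)+

end

lemma norm_Unitization_0 [simp]: "norm (Unitization a 0) = norm (a::'a::cstar_algebra)"
  by (simp add: norm_unitization_def onorm_left_action_embed)

lemma cmod_scal_le: "cmod (scal u) \<le> norm (u::'a::cstar_algebra unitization)"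
  by (simp add: norm_unitization_def)

lemma Unitization_eq: "Unitization a c = Unitization a 0 + Unitization 0 c"
  by (simp add: unitization_eq_iff)

lemma norm_Unitization_scal: "norm (Unitization 0 c :: 'a::cstar_algebra unitization) = cmod c"
proof -
  have "onorm (left_action (Unitization (0::'a) c)) \<le> cmod c"
    by (rule onorm_bound) (simp_all add: left_action_def norm_scaleC)
  then show ?thesis by (simp add: norm_unitization_def)
qed

lemma norm_Unitization_le: "norm (Unitization a c) \<le> norm (a::'a::cstar_algebra) + cmod c"
  using norm_triangle_ineq[of "Unitization a 0" "Unitization 0 c"]
  by (simp add: Unitization_eq[symmetric] norm_Unitization_scal)

lemma norm_base_le: "norm (base u) \<le> 2 * norm (u::'a::cstar_algebra unitization)"
proof -
  have "Unitization (base u) 0 = u - Unitization 0 (scal u)" by (simp add: unitization_eq_iff)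
  then have "norm (base u) \<le> norm u + cmod (scal u)"
    using norm_triangle_ineq4[of u "Unitization 0 (scal u)"]
    by (metis norm_Unitization_0 norm_Unitization_scal)
  then show ?thesis using cmod_scal_le[of u] by simp
qed

lemma Cauchy_of_norm_diff_le:
  fixes x :: "nat \<Rightarrow> 'b::real_normed_vector" and z :: "nat \<Rightarrow> 'c::real_normed_vector"
  assumes z: "Cauchy z" and le: "\<And>m n. norm (x m - x n) \<le> C * norm (z m - z n)"
  shows "Cauchy x"
proof (rule CauchyI)
  fix e :: real assume "e > 0"
  then have "e / (\<bar>C\<bar> + 1) > 0" by simp
  then obtain M where M: "\<forall>m\<ge>M. \<forall>n\<ge>M. norm (z m - z n) < e / (\<bar>C\<bar> + 1)"
    using z CauchyD by blast
  have "norm (x m - x n) < e" if "m \<ge> M" "n \<ge> M" for m n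
  proof -
    have "norm (x m - x n) \<le> (\<bar>C\<bar> + 1) * norm (z m - z n)"
      by (rule order_trans[OF le]) (simp add: mult_right_mono)
    also have "\<dots> < e" using M that by (simp add: field_simps)
    finally show ?thesis .
  qed
  then show "\<exists>M. \<forall>m\<ge>M. \<forall>n\<ge>M. norm (x m - x n) < e" by blast
qed

instantiation unitization :: (cstar_algebra) cstar_algebra
begin

definition "c *\<^sub>C u = Unitization (c *\<^sub>C base u) (c * scal u)"
definition "star u = Unitization (star (base u)) (cnj (scal u))"

instance
proof
  fix u v :: "'a unitization" and c d :: complex and r :: real
  show "c *\<^sub>C (u + v) = c *\<^sub>C u + c *\<^sub>C v"
    by (simp add: scaleC_unitization_def unitization_eq_iff scaleC_add_right algebra_simps)
  show "(c + d) *\<^sub>C u = c *\<^sub>C u + d *\<^sub>C u"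
    by (simp add: scaleC_unitization_def unitization_eq_iff scaleC_add_left algebra_simps)
  show "c *\<^sub>C d *\<^sub>C u = (c * d) *\<^sub>C u"
    by (simp add: scaleC_unitization_def unitization_eq_iff scaleC_scaleC)
  show "r *\<^sub>R u = complex_of_real r *\<^sub>C u"
    by (simp add: scaleC_unitization_def unitization_eq_iff scaleR_eq_scaleC
        scaleR_conv_of_real[where 'a = complex])
  show "c *\<^sub>C u * v = c *\<^sub>C (u * v)" "u * c *\<^sub>C v = c *\<^sub>C (u * v)"
    by (simp_all add: scaleC_unitization_def unitization_eq_iff scaleC_add_right scaleC_scaleC
        mult_scaleC_left mult_scaleC_right mult_ac)
  show "star (u + v) = star u + star v"
    by (simp add: star_unitization_def unitization_eq_iff star_add)
  show "star (c *\<^sub>C u) = cnj c *\<^sub>C star u"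
    by (simp add: star_unitization_def scaleC_unitization_def unitization_eq_iff star_scaleC)
  show "star (u * v) = star v * star u"
    by (simp add: star_unitization_def unitization_eq_iff star_add star_mult star_scaleC mult.commute)
  show "star (star u) = u"
    by (simp add: star_unitization_def unitization_eq_iff star_star)
  show "norm (c *\<^sub>C u) = cmod c * norm u"
  proof -
    note bl = bounded_linear_left_action
    have "onorm (left_action (c *\<^sub>C u)) = cmod c * onorm (left_action u)"
    proof -
      have eq: "norm (left_action (c *\<^sub>C u) x) = norm (cmod c *\<^sub>R left_action u x)" for x
        by (simp add: left_action_def scaleC_unitization_def mult_scaleC_left
            scaleC_scaleC[symmetric] scaleC_add_right[symmetric] norm_scaleC)
      have "onorm (left_action (c *\<^sub>C u)) = onorm (\<lambda>x. cmod c *\<^sub>R left_action u x)"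
        unfolding onorm_def eq ..
      then show ?thesis by (simp add: onorm_scaleR[OF bl])
    qed
    then show ?thesis
      by (simp add: norm_unitization_def max_mult_distrib_left norm_mult scaleC_unitization_def)
  qed
  show "norm (star u * u) = (norm u)\<^sup>2"
  proof -
    note bl = bounded_linear_left_action
    let ?o = "\<lambda>w::'a unitization. onorm (left_action w)"
    have o0: "?o w \<ge> 0" for w by (rule onorm_pos_le[OF bl])
    \<comment> \<open>The C*-identity of the algebra, applied to the vectors
      \<open>left_action w x\<close>, passes to the operator norm.\<close>
    have ge: "(?o w)\<^sup>2 \<le> ?o (star w * w)" for w
    proof -
      have "?o w \<le> sqrt (?o (star w * w))"
      proof (rule onorm_bound)
        show "0 \<le> sqrt (?o (star w * w))" using o0 by simp
        fix x
        have "star (left_action w x) * left_action w x = star x * left_action (star w * w) x"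
          by (simp add: left_action_def star_unitization_def star_add star_mult star_scaleC
              algebra_simps mult_scaleC_left mult_scaleC_right scaleC_scaleC scaleC_add_right)
        then have "(norm (left_action w x))\<^sup>2 \<le> norm x * norm (left_action (star w * w) x)"
          using cstar_identity[of "left_action w x"] norm_mult_ineq[of "star x"] by (metis norm_star)
        also have "\<dots> \<le> norm x * (?o (star w * w) * norm x)"
          by (intro mult_left_mono onorm[OF bl]) simp
        finally have "(norm (left_action w x))\<^sup>2 \<le> (sqrt (?o (star w * w)) * norm x)\<^sup>2"
          using o0 by (simp add: power_mult_distrib power2_eq_square mult_ac)
        then show "norm (left_action w x) \<le> sqrt (?o (star w * w)) * norm x"
          by (rule power2_le_imp_le) (use o0 in simp)
      qed
      then have "(?o w)\<^sup>2 \<le> (sqrt (?o (star w * w)))\<^sup>2" using o0 by (intro power_mono)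
      then show ?thesis using o0 by simp
    qed
    have le: "?o (star w * w) \<le> ?o (star w) * ?o w" for w
    proof -
      have "left_action (star w * w) = left_action (star w) \<circ> left_action w"
        by (simp add: fun_eq_iff left_action_mult)
      then show ?thesis using onorm_compose[OF bl bl] by metis
    qed
    have ss: "star (star w) = w" for w :: "'a unitization"
      by (simp add: star_unitization_def unitization_eq_iff star_star)
    \<comment> \<open>Cancelling \<open>?o w\<close>, as in \<open>norm_star\<close>, makes the
      operator norm invariant under \<open>star\<close> and turns \<open>ge\<close> and
      \<open>le\<close> into an equality.\<close>
    have o_le: "?o w \<le> ?o (star w)" for w
    proof (cases "?o w = 0")
      case False
      then have "?o w > 0" using o0[of w] by simp
      moreover have "?o w * ?o w \<le> ?o (star w) * ?o w"
        using ge[of w] le[of w] by (simp add: power2_eq_square)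
      ultimately show ?thesis by simp
    qed (simp add: o0)
    have "?o (star u) = ?o u" using o_le[of u] o_le[of "star u"] by (simp add: ss)
    then have o: "?o (star u * u) = (?o u)\<^sup>2"
      using ge[of u] le[of u] by (simp add: power2_eq_square)
    have sc: "cmod (scal (star u * u)) = (cmod (scal u))\<^sup>2"
      by (simp add: star_unitization_def norm_mult power2_eq_square)
    show ?thesis unfolding norm_unitization_def o sc
      using o0[of u] by (auto simp: max_def power_mono dest: power2_le_imp_le)
  qed
next
  fix X :: "nat \<Rightarrow> 'a unitization" assume X: "Cauchy X"
  \<comment> \<open>Both coordinates are Lipschitz for the norm, with constants 1 and 2, so they
    converge separately.\<close>
  have "Cauchy (\<lambda>n. scal (X n))"
    by (rule Cauchy_of_norm_diff_le[OF X, of _ 1]) (simp flip: unitization_ops(10) add: cmod_scal_le)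
  then obtain c where c: "(\<lambda>n. scal (X n)) \<longlonglongrightarrow> c"
    using Cauchy_convergent_iff convergent_def by blast
  have "Cauchy (\<lambda>n. base (X n))"
    by (rule Cauchy_of_norm_diff_le[OF X, of _ 2]) (simp flip: unitization_ops(9) add: norm_base_le)
  then obtain a where a: "(\<lambda>n. base (X n)) \<longlonglongrightarrow> a"
    using Cauchy_convergent_iff convergent_def by blast
  have "(\<lambda>n. norm (base (X n) - a) + cmod (scal (X n) - c)) \<longlonglongrightarrow> 0"
    by (intro tendsto_add_zero tendsto_norm_zero LIM_zero a c)
  then have "(\<lambda>n. X n - Unitization a c) \<longlonglongrightarrow> 0"
  proof (rule Lim_null_comparison[rotated], intro always_eventually allI)
    fix n
    have "X n - Unitization a c = Unitization (base (X n) - a) (scal (X n) - c)"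
      by (simp add: unitization_eq_iff)
    then show "norm (X n - Unitization a c) \<le> norm (base (X n) - a) + cmod (scal (X n) - c)"
      using norm_Unitization_le by metis
  qed
  then show "convergent X" using LIM_zero_iff convergent_def by blast
qed

end

lemma Unitization_0_mult: "Unitization a 0 * Unitization b 0 = Unitization (a * b :: 'a::cstar_algebra) 0"
  by (simp add: unitization_eq_iff)

lemma Unitization_0_add: "Unitization a 0 + Unitization b 0 = Unitization (a + b :: 'a::cstar_algebra) 0"
  by (simp add: unitization_eq_iff)

lemma star_Unitization_0: "star (Unitization a 0) = Unitization (star a :: 'a::cstar_algebra) 0"
  by (simp add: unitization_eq_iff star_unitization_def)

section \<open>Consequences for algebras without assumed unit\<close>

lemma norm_star_mult_self_le:
  fixes x y :: "'a::cstar_algebra"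
  shows "(norm x)\<^sup>2 \<le> norm (star x * x + star y * y)"
proof -
  \<comment> \<open>\<open>cpos_norm_mono\<close> is stated for unital algebras; the isometric
    embedding into the unitization supplies the unit.\<close>
  let ?e = "\<lambda>a::'a. Unitization a 0"
  have "norm (star (?e x) * ?e x) \<le> norm (star (?e x) * ?e x + star (?e y) * ?e y)"
    by (intro cpos_norm_mono cpos_star_mult_self)
  then show ?thesis
    by (simp add: star_Unitization_0 Unitization_0_mult Unitization_0_add cstar_identity)
qed

lemma one_minus_right_inverse:
  fixes f :: "'u::{real_normed_algebra_1, banach}"
  assumes "norm f < 1"
  obtains v where "(1 - f) * v = 1"
proof -
  have s: "summable (\<lambda>n. f ^ n)" using assms by (rule complete_algebra_summable_geometric)
  have "f * (\<Sum>n. f ^ n) = (\<Sum>n. f ^ Suc n)" using suminf_mult[OF s, of f] by simp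
  also have "\<dots> = (\<Sum>n. f ^ n) - 1" using suminf_split_head[OF s] by simp
  finally show thesis using that[of "\<Sum>n. f ^ n"] by (simp add: algebra_simps)
qed

text \<open>\<open>1 + h\<close> is a right inverse of \<open>1 - f\<close> in the unitization, so
  this expresses invertibility inside the algebra.\<close>

lemma quasi_inverse_of_norm_less_1:
  fixes f :: "'a::cstar_algebra"
  assumes "norm f < 1"
  obtains h where "h = f + f * h"
proof -
  obtain v where v: "(1 - Unitization f 0) * v = 1"
    using one_minus_right_inverse[of "Unitization f 0"] assms by auto
  then have "scal v = 1" by (simp add: unitization_eq_iff)
  with v have "base v = f + f * base v" by (simp add: unitization_eq_iff algebra_simps)
  then show thesis by (rule that)
qed

text \<open>\<open>1 + g\<close> is a right inverse of \<open>1 + h\<close> in the unitization, with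
  \<open>h = star b * b\<close>. For \<open>t = norm h\<close>, \<open>1 + h\<close> is
  \<open>1 + t\<close> times a perturbation of 1 of size at most \<open>t / (1 + t)\<close>, so a
  Neumann series inverts it. The bound 2 is crude; what matters is that it does not depend on
  \<open>b\<close>.\<close>

lemma quasi_inverse_star_mult_self:
  fixes b :: "'a::cstar_algebra"
  obtains g where "g + star b * b + star b * b * g = 0" "norm (b + b * g) \<le> 2"
proof -
  define B where "B = Unitization b 0"
  define h where "h = star B * B"
  define t where "t = norm h"
  have h: "cpos h" unfolding h_def by (rule cpos_star_mult_self)
  have t: "t \<ge> 0" "norm (t *\<^sub>R 1 - h) \<le> t" using cpos_norm_le[OF h] by (simp_all add: t_def)
  have "norm (t *\<^sub>R 1 - h) / (1 + t) < 1" using t by (simp add: field_simps)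
  then have "norm ((1 / (1 + t)) *\<^sub>R (t *\<^sub>R 1 - h)) < 1" using t(1) by simp
  then obtain v where v: "(1 - (1 / (1 + t)) *\<^sub>R (t *\<^sub>R 1 - h)) * v = 1"
    using one_minus_right_inverse by blast
  define w where "w = (1 / (1 + t)) *\<^sub>R v"
  have "(t + t * t) / (1 + t) = t" using t(1) by (simp add: field_simps)
  then have "1 + h = (1 + t) *\<^sub>R (1 - (1 / (1 + t)) *\<^sub>R (t *\<^sub>R 1 - h))"
    using t(1) by (simp add: algebra_simps)
  then have "(1 + h) * v = (1 + t) *\<^sub>R 1" using v by simp
  moreover have "w + h * w = (1 / (1 + t)) *\<^sub>R ((1 + h) * v)" by (simp add: w_def algebra_simps)
  ultimately have w: "w + h * w = 1" using t(1) by simp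
  have nw: "norm w \<le> 1" using norm_le_norm_one_plus_cpos_mult[OF h, of w] w by simp
  have hB: "h = Unitization (star b * b) 0"
    by (simp add: h_def B_def star_Unitization_0 Unitization_0_mult)
  have sw: "scal w = 1" using w by (simp add: unitization_eq_iff hB)
  have g: "base w + star b * b + star b * b * base w = 0"
    using w by (simp add: unitization_eq_iff hB sw algebra_simps)
  \<comment> \<open>Substituting \<open>1 - w\<close> for \<open>h * w\<close> removes the
    dependence on \<open>norm b\<close>.\<close>
  have "h * w = 1 - w" using w by (simp add: algebra_simps)
  then have "star (B * w) * (B * w) = star w * (1 - w)"
    by (simp add: star_mult h_def mult.assoc)
  then have "(norm (B * w))\<^sup>2 \<le> norm w * norm (1 - w)"
    using cstar_identity[of "B * w"] norm_mult_ineq[of "star w" "1 - w"] by simp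
  also have "\<dots> \<le> 1 * 2"
    using nw norm_triangle_ineq4[of 1 w] by (intro mult_mono) auto
  finally have "(norm (B * w))\<^sup>2 \<le> 2\<^sup>2" by simp
  then have "norm (B * w) \<le> 2" by (rule power2_le_imp_le) simp
  moreover have "B * w = Unitization (b + b * base w) 0"
    by (simp add: unitization_eq_iff B_def sw add.commute)
  ultimately show thesis using g that by simp
qed

section \<open>Ideals and quotients\<close>

lemma csubspace_add: "csubspace V \<Longrightarrow> x \<in> V \<Longrightarrow> y \<in> V \<Longrightarrow> x + y \<in> V"
  by (simp add: csubspace_def)

lemma csubspace_minus: "csubspace V \<Longrightarrow> x \<in> V \<Longrightarrow> - x \<in> V"
  unfolding csubspace_def by (metis scaleC_minus_one)

lemma csubspace_diff: "csubspace V \<Longrightarrow> x \<in> V \<Longrightarrow> y \<in> V \<Longrightarrow> x - y \<in> V"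
  using csubspace_add[of V x "- y"] csubspace_minus[of V y] by simp

lemma csubspace_UNIV [simp]: "csubspace UNIV"
  by (simp add: csubspace_def)

text \<open>
  If \<open>g\<close> solves \<open>(1 + r\<^sup>2 k k\<^sup>*) (1 + g) = 1\<close> then \<open>g \<in> K\<close>, and \<open>k\<^sup>* (1 + g)\<close> has norm at most \<open>2 / r\<close>.
\<close>

lemma cstar_ideal_star_closed:
  assumes K: "cstar_ideal K" and k: "k \<in> K"
  shows "star k \<in> K"
proof -
  have V: "csubspace K" and mult: "\<And>x a. x \<in> K \<Longrightarrow> a * x \<in> K \<and> x * a \<in> K" and "closed K"
    using K by (auto simp: cstar_ideal_def)
  have "\<exists>y\<in>K. dist y (star k) < e" if e: "e > 0" for e
  proof -
    \<comment> \<open>Chosen so that \<open>2 / r\<close> falls strictly below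
      \<open>e\<close>.\<close>
    define r where "r = 3 / e"
    have r: "r > 0" using e by (simp add: r_def)
    define b where "b = r *\<^sub>R star k"
    obtain g where g: "g + star b * b + star b * b * g = 0" and le: "norm (b + b * g) \<le> 2"
      using quasi_inverse_star_mult_self by metis
    have "star b * b = k * ((r * r) *\<^sub>R star k)" by (simp add: b_def star_scaleR star_star)
    then have "star b * b \<in> K" using mult k by metis
    moreover have "g = - (star b * b) - star b * b * g" using g by (simp add: algebra_simps eq_neg_iff_add_eq_0)
    ultimately have "g \<in> K" using V mult by (metis csubspace_diff csubspace_minus)
    then have mem: "- (star k * g) \<in> K" using V mult csubspace_minus by blast
    have "b + b * g = r *\<^sub>R (star k + star k * g)" by (simp add: b_def algebra_simps)
    then have "r * norm (star k + star k * g) \<le> 2" using le r by (simp del: scaleR_add_right)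
    then have "norm (star k + star k * g) \<le> 2 / r" using r by (simp add: field_simps)
    moreover have "2 / r < e" using e by (simp add: r_def)
    ultimately have "norm (star k + star k * g) < e" by (rule le_less_trans)
    then have "dist (- (star k * g)) (star k) < e"
      by (subst dist_commute) (simp add: dist_norm)
    with mem show ?thesis by blast
  qed
  then show ?thesis using \<open>closed K\<close> closed_approachable by blast
qed

text \<open>The left annihilator of \<open>K\<close> is a closed two-sided ideal. An
  \<open>x\<close> in both it and \<open>K\<close> satisfies \<open>x * (star x * x) = 0\<close>,
  hence \<open>x = 0\<close>; so it is zero by essentiality.\<close>

lemma essential_ideal_annihilator:
  assumes "essential_ideal K" and z: "\<And>k. k \<in> K \<Longrightarrow> z * k = 0"
  shows "z = 0"
proof -
  have K: "cstar_ideal K" using assms(1) by (simp add: essential_ideal_def)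
  then have mult: "\<And>x a. x \<in> K \<Longrightarrow> a * x \<in> K \<and> x * a \<in> K" by (auto simp: cstar_ideal_def)
  define J where "J = {z. \<forall>k\<in>K. z * k = 0}"
  have "J = (\<Inter>k\<in>K. {z. z * k = 0})" by (auto simp: J_def)
  moreover have "closed (\<Inter>k\<in>K. {z. z * k = 0})"
    by (intro closed_INT ballI closed_Collect_eq continuous_intros)
  ultimately have "closed J" by simp
  then have J: "cstar_ideal J"
    using mult by (auto simp: cstar_ideal_def csubspace_def J_def distrib_right mult_scaleC_left mult.assoc)
  have "x = 0" if "x \<in> K" "x \<in> J" for x
  proof -
    have "x * (star x * x) = 0" using that mult by (auto simp: J_def)
    then have "star (star x * x) * (star x * x) = 0"
      by (simp add: star_mult star_star mult.assoc)
    then show ?thesis by (simp add: star_mult_self_eq_0_iff)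
  qed
  moreover have "0 \<in> K" "0 \<in> J" using K J by (auto simp: cstar_ideal_def csubspace_def)
  ultimately have "K \<inter> J = {0}" by blast
  then have "J = {0}" using assms(1) J by (auto simp: essential_ideal_def)
  moreover have "z \<in> J" using z by (simp add: J_def)
  ultimately show ?thesis by simp
qed

text \<open>The union \<open>quotient_mult\<close> contains the product of the chosen
  representatives, so equations between cosets become congruences modulo \<open>K\<close>.\<close>

lemma quotient_unit_representative:
  assumes "csubspace K" and "unital_on (quotient_carrier K) (quotient_mult K)"
  obtains e where "\<And>a. e * a - a \<in> K" "\<And>a. a * e - a \<in> K"
proof -
  let ?c = "\<lambda>a. ideal_rel K `` {a}"
  have self: "a \<in> ?c a" for a
    using assms(1) by (simp add: ideal_rel_def csubspace_def)
  obtain e where e: "\<And>a. quotient_mult K (?c e) (?c a) = ?c a"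
      "\<And>a. quotient_mult K (?c a) (?c e) = ?c a"
    using assms(2) by (auto simp: unital_on_def quotient_carrier_def quotient_def)
  have prod: "a * b \<in> quotient_mult K (?c a) (?c b)" for a b
    unfolding quotient_mult_def using self by blast
  have "a - e * a \<in> K" "a - a * e \<in> K" for a
    using prod[of e a] prod[of a e] unfolding e by (simp_all add: ideal_rel_def)
  then show thesis
    using that csubspace_minus[OF assms(1)] by (metis minus_diff_eq)
qed

text \<open>Take \<open>d\<close> in \<open>D\<close> within distance 1 of \<open>e\<close>, and let
  \<open>h\<close> be the quasi-inverse of \<open>f = e - d\<close>. Modulo \<open>K\<close>,
  \<open>d * (e + h)\<close> is \<open>(1 - f) * (1 + h) = 1\<close>, and it stays in the right
  ideal \<open>D\<close>.\<close>

lemma dense_right_ideal_meets_unit_coset: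
  assumes K: "cstar_ideal K" and e: "\<And>a. e * a - a \<in> K"
    and D: "csubspace D" "\<And>x a. x \<in> D \<Longrightarrow> x * a \<in> D" "closure D = UNIV"
    and e': "\<And>a. a * e - a \<in> K"
  obtains x where "x \<in> D" "x - e \<in> K"
proof -
  have V: "csubspace K" and mult: "\<And>x a. x \<in> K \<Longrightarrow> a * x \<in> K \<and> x * a \<in> K"
    using K by (auto simp: cstar_ideal_def)
  obtain d where d: "d \<in> D" "dist d e < 1"
    using D(3) closure_approachable[of e D] by (metis UNIV_I zero_less_one)
  define f where "f = e - d"
  have "norm f < 1" using d(2) by (simp add: f_def dist_norm norm_minus_commute)
  then obtain h where h: "h = f + f * h" using quasi_inverse_of_norm_less_1 by metis
  have "d * (e + h) - e = (e * e - e) + (e * h - h) + (h - f - f * h) - (f * e - f)"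
    by (simp add: f_def algebra_simps)
  moreover have "h - f - f * h = 0" using h by (simp add: algebra_simps)
  ultimately have "d * (e + h) - e = (e * e - e) + (e * h - h) - (f * e - f)" by simp
  then have "d * (e + h) - e \<in> K" using e e' V by (simp only: csubspace_add csubspace_diff)
  then show thesis using that d(1) D(2) by blast
qed

section \<open>Adjoints and regular operators\<close>

lemma left_mult_eq_on_dense:
  fixes a b :: "'a::cstar_algebra"
  assumes "\<And>x. x \<in> D \<Longrightarrow> a * x = b * x" and "B \<subseteq> closure D" and "x \<in> B"
  shows "a * x = b * x"
proof -
  have "closed {x. a * x = b * x}" by (intro closed_Collect_eq continuous_intros)
  then have "closure D \<subseteq> {x. a * x = b * x}" using assms(1) by (intro closure_minimal) auto
  then show ?thesis using assms(2,3) by blast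
qed

text \<open>For two candidates, left multiplications by \<open>star b\<close> and
  \<open>star b'\<close> agree on a set whose closure contains \<open>B\<close>, hence at
  \<open>b - b'\<close> itself, so \<open>star (b - b') * (b - b') = 0\<close>.\<close>

lemma op_adjoint_eq_Some_iff:
  assumes dense: "densely_defined_on B T" and B: "csubspace B"
  shows "op_adjoint B T a = Some b \<longleftrightarrow> adjoint_rel B T a b"
proof -
  have uniq: "b = b'" if b: "adjoint_rel B T a b" and b': "adjoint_rel B T a b'" for b b'
  proof -
    have "star b * x = star b' * x" if "x \<in> dom T" for x
      using b b' that by (auto simp: adjoint_rel_def cinner_def)
    moreover have "b - b' \<in> B" using b b' B by (simp add: adjoint_rel_def csubspace_diff)
    ultimately have "star b * (b - b') = star b' * (b - b')"
      using dense left_mult_eq_on_dense[of "dom T" "star b" "star b'" B "b - b'"]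
      by (simp add: densely_defined_on_def)
    then have "star (b - b') * (b - b') = 0" by (simp add: star_diff algebra_simps)
    then show ?thesis by (simp add: star_mult_self_eq_0_iff)
  qed
  show ?thesis
  proof
    assume "op_adjoint B T a = Some b"
    then obtain b' where b': "adjoint_rel B T a b'" "b = (THE b. adjoint_rel B T a b)"
      by (auto simp: op_adjoint_def split: if_splits)
    then show "adjoint_rel B T a b" using theI[of "adjoint_rel B T a", OF b'(1) uniq[OF _ b'(1)]] by simp
  next
    assume "adjoint_rel B T a b"
    then show "op_adjoint B T a = Some b"
      using uniq by (auto simp: op_adjoint_def intro!: the_equality)
  qed
qed

lemma adjoint_rel_iff:
  "adjoint_rel B T a b \<longleftrightarrow> a \<in> B \<and> b \<in> B \<and> (\<forall>x y. T x = Some y \<longrightarrow> star a * y = star b * x)"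
  by (force simp: adjoint_rel_def cinner_def dom_def)

lemma closed_adjoint_rel:
  assumes "closed B"
  shows "closed {(a, b). adjoint_rel B T a b}"
proof -
  have "{(a, b). adjoint_rel B T a b} =
      B \<times> B \<inter> (\<Inter>p\<in>Map.graph T. {q. star (fst q) * snd p = star (snd q) * fst p})"
    by (auto simp: adjoint_rel_iff Map.graph_def)
  moreover have "closed \<dots>"
    by (intro closed_Int closed_Times assms closed_INT ballI closed_Collect_eq continuous_intros
        bounded_linear.continuous_on[OF bounded_linear_star])
  ultimately show ?thesis by simp
qed

lemma graph_op_adjoint:
  assumes "densely_defined_on B T" "csubspace B"
  shows "Map.graph (op_adjoint B T) = {(a, b). adjoint_rel B T a b}"
  using op_adjoint_eq_Some_iff[OF assms] by (auto simp: Map.graph_def)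

lemma closed_op_adjoint:
  assumes "densely_defined_on B T" "csubspace B" "closed B"
  shows "closed_op (op_adjoint B T)"
  using closed_adjoint_rel[OF assms(3)] by (simp add: closed_op_def graph_op_adjoint[OF assms(1,2)])

lemma operator_on_graph_add:
  assumes T: "operator_on B T" and "T x = Some u" "T y = Some v"
  shows "T (x + y) = Some (u + v)"
proof -
  have "x \<in> dom T" "y \<in> dom T" using assms by auto
  then have "x + y \<in> dom T" "the (T (x + y)) = the (T x) + the (T y)"
    using T unfolding operator_on_def csubspace_def by blast+
  then show ?thesis using assms by auto
qed

lemma operator_on_graph_scaleC:
  assumes T: "operator_on B T" and "T x = Some u"
  shows "T (c *\<^sub>C x) = Some (c *\<^sub>C u)"
proof -
  have "x \<in> dom T" using assms by auto
  then have "c *\<^sub>C x \<in> dom T" "the (T (c *\<^sub>C x)) = c *\<^sub>C the (T x)"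
    using T unfolding operator_on_def csubspace_def by blast+
  then show ?thesis using assms by auto
qed

lemma operator_on_graph_diff:
  assumes "operator_on B T" and "T x = Some u" "T y = Some v"
  shows "T (x - y) = Some (u - v)"
  using operator_on_graph_add[OF assms(1,2) operator_on_graph_scaleC[OF assms(1,3), of "-1"]]
  by simp

lemma operator_on_graph_zero:
  assumes "operator_on B T"
  shows "T 0 = Some 0"
proof -
  obtain w where "T 0 = Some w" using assms by (auto simp: operator_on_def csubspace_def)
  with operator_on_graph_diff[OF assms this this] show ?thesis by simp
qed

lemma operator_on_op_adjoint:
  assumes "densely_defined_on B T" and B: "csubspace B"
  shows "operator_on B (op_adjoint B T)"
proof -
  note iff = op_adjoint_eq_Some_iff[OF assms]
  have add: "op_adjoint B T (a + a') = Some (b + b')"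
    if "op_adjoint B T a = Some b" "op_adjoint B T a' = Some b'" for a a' b b'
    using that B by (simp add: iff adjoint_rel_iff csubspace_add star_add algebra_simps)
  have scale: "op_adjoint B T (c *\<^sub>C a) = Some (c *\<^sub>C b)"
    if "op_adjoint B T a = Some b" for a b c
    using that B by (simp add: iff adjoint_rel_iff csubspace_def star_scaleC mult_scaleC_left)
  have zero: "op_adjoint B T 0 = Some 0"
    using B by (simp add: iff adjoint_rel_iff csubspace_def)
  have "dom (op_adjoint B T) \<subseteq> B" "ran (op_adjoint B T) \<subseteq> B"
    using iff by (auto simp: ran_def adjoint_rel_iff)
  then show ?thesis
    using add scale zero unfolding operator_on_def csubspace_def by (fastforce simp: dom_def)
qed

text \<open>The norm of \<open>x + v\<close> dominates those of \<open>x\<close> and \<open>u\<close>, because \<open>x\<^sup>* (x + v) = x\<^sup>* x + u\<^sup>* u\<close>.\<close>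

lemma closed_range_one_plus_adjoint_comp:
  fixes G H :: "('a::cstar_algebra \<times> 'a) set"
  assumes G: "closed G" "\<And>p q. p \<in> G \<Longrightarrow> q \<in> G \<Longrightarrow> p - q \<in> G"
    and H: "closed H" "\<And>p q. p \<in> H \<Longrightarrow> q \<in> H \<Longrightarrow> p - q \<in> H"
    and adj: "\<And>x u y v. (x, u) \<in> G \<Longrightarrow> (y, v) \<in> H \<Longrightarrow> star u * y = star x * v"
  shows "closed {x + v | x u v. (x, u) \<in> G \<and> (u, v) \<in> H}"
proof -
  have bounds: "norm x \<le> norm (x + v) \<and> norm u \<le> norm (x + v)" if "(x, u) \<in> G" "(u, v) \<in> H" for x u v
  proof -
    have eq: "star x * x + star u * u = star x * (x + v)"
      using adj[OF that] by (simp add: distrib_left)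
    have le: "norm (star x * (x + v)) \<le> norm x * norm (x + v)"
      using norm_mult_ineq[of "star x"] by simp
    have "norm x * norm x \<le> norm x * norm (x + v)"
      using norm_star_mult_self_le[of x u] le unfolding eq by (simp add: power2_eq_square)
    then have 1: "norm x \<le> norm (x + v)" by (cases "x = 0") auto
    have "(norm u)\<^sup>2 \<le> norm x * norm (x + v)"
      using norm_star_mult_self_le[of u x] le eq by (simp add: add.commute)
    also have "\<dots> \<le> (norm (x + v))\<^sup>2"
      using 1 by (simp add: power2_eq_square mult_right_mono)
    finally have "norm u \<le> norm (x + v)" by (rule power2_le_imp_le) simp
    with 1 show ?thesis by simp
  qed
  show ?thesis
  proof (rule closed_sequential_limits[THEN iffD2])
    show "\<forall>z l. (\<forall>n. z n \<in> {x + v | x u v. (x, u) \<in> G \<and> (u, v) \<in> H}) \<and> z \<longlonglongrightarrow> l \<longrightarrow>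
        l \<in> {x + v | x u v. (x, u) \<in> G \<and> (u, v) \<in> H}"
    proof (intro allI impI, elim conjE)
      fix z l assume "\<forall>n. z n \<in> {x + v | x u v. (x, u) \<in> G \<and> (u, v) \<in> H}" and z: "z \<longlonglongrightarrow> l"
      then have "\<forall>n. \<exists>x u v. z n = x + v \<and> (x, u) \<in> G \<and> (u, v) \<in> H" by blast
      then obtain x u v where xuv: "\<And>n. z n = x n + v n" "\<And>n. (x n, u n) \<in> G" "\<And>n. (u n, v n) \<in> H"
        by metis
      have le: "norm (x m - x n) \<le> 1 * norm (z m - z n) \<and> norm (u m - u n) \<le> 1 * norm (z m - z n)" for m n
      proof -
        have "(x m - x n, u m - u n) \<in> G" "(u m - u n, v m - v n) \<in> H"
          using G(2)[OF xuv(2) xuv(2), of m n] H(2)[OF xuv(3) xuv(3), of m n] by simp_all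
        moreover have "(x m - x n) + (v m - v n) = z m - z n" by (simp add: xuv(1))
        ultimately show ?thesis using bounds by (metis mult_1)
      qed
      have "Cauchy z" using z by (rule LIMSEQ_imp_Cauchy)
      then have "Cauchy x" "Cauchy u" using le Cauchy_of_norm_diff_le by blast+
      then obtain x0 u0 where lim: "x \<longlonglongrightarrow> x0" "u \<longlonglongrightarrow> u0"
        using Cauchy_convergent_iff convergent_def by metis
      have "v = (\<lambda>n. z n - x n)" by (simp add: xuv(1))
      then have v: "v \<longlonglongrightarrow> l - x0" using tendsto_diff[OF z lim(1)] by simp
      have "(x0, u0) \<in> G"
        using closed_sequentially[OF G(1) xuv(2) tendsto_Pair[OF lim]] .
      moreover have "(u0, l - x0) \<in> H"
        using closed_sequentially[OF H(1) xuv(3) tendsto_Pair[OF lim(2) v]] .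
      ultimately show "l \<in> {x + v | x u v. (x, u) \<in> G \<and> (u, v) \<in> H}"
        by (intro CollectI exI[of _ x0] exI[of _ u0] exI[of _ "l - x0"]) simp
    qed
  qed
qed

text \<open>
  Solving \<open>w + T\<^sup>*T w = T\<^sup>* y\<close> for \<open>w\<close> and putting \<open>v = y - T w\<close> gives \<open>v + T T\<^sup>* v = y\<close>, so the range
  of \<open>1 + T T\<^sup>*\<close> contains the dense set \<open>D(T\<^sup>*)\<close>.
\<close>

lemma regular_on_range_adjoint_comp:
  assumes T: "regular_on B T" and B: "csubspace B" "closed B" and c: "c \<in> B"
  obtains v w u where "op_adjoint B T v = Some w" "T w = Some u" "c = v + u"
proof -
  have op: "operator_on B T" and cl: "closed_op T" and dense: "densely_defined_on B T"
    and dense': "densely_defined_on B (op_adjoint B T)"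
    and range: "B \<subseteq> closure {x + y | x y. (op_adjoint B T \<circ>\<^sub>m T) x = Some y}"
    using T by (auto simp: regular_on_def)
  note iff = op_adjoint_eq_Some_iff[OF dense B(1)]
  define G where "G = Map.graph T"
  define H where "H = Map.graph (op_adjoint B T)"
  have G: "closed G" "\<And>p q. p \<in> G \<Longrightarrow> q \<in> G \<Longrightarrow> p - q \<in> G"
    using cl operator_on_graph_diff[OF op] by (auto simp: G_def closed_op_def Map.graph_def)
  have H: "closed H" "\<And>p q. p \<in> H \<Longrightarrow> q \<in> H \<Longrightarrow> p - q \<in> H"
    using closed_op_adjoint[OF dense B] operator_on_graph_diff[OF operator_on_op_adjoint[OF dense B(1)]]
    by (auto simp: H_def closed_op_def Map.graph_def)
  have HG: "star u * y = star x * v" if "(x, u) \<in> H" "(y, v) \<in> G" for x u y v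
    using that by (auto simp: H_def G_def Map.graph_def iff adjoint_rel_iff)
  have GH: "star u * y = star x * v" if "(x, u) \<in> G" "(y, v) \<in> H" for x u y v
    using arg_cong[OF HG[OF that(2,1)], of star] by (simp add: star_mult star_star)
  have "{x + y | x y. (op_adjoint B T \<circ>\<^sub>m T) x = Some y} \<subseteq> {x + v | x u v. (x, u) \<in> G \<and> (u, v) \<in> H}"
    by (auto simp: map_comp_Some_iff G_def H_def Map.graph_def)
  \<comment> \<open>The range is dense by regularity and closed by the preceding lemma, so it
    contains \<open>B\<close>.\<close>
  then have B1: "B \<subseteq> {x + v | x u v. (x, u) \<in> G \<and> (u, v) \<in> H}"
    using range closed_range_one_plus_adjoint_comp[OF G H GH] closure_minimal by blast
  have "dom (op_adjoint B T) \<subseteq> {x + v | x u v. (x, u) \<in> H \<and> (u, v) \<in> G}"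
  proof
    fix y assume "y \<in> dom (op_adjoint B T)"
    then obtain b where yb: "(y, b) \<in> H" by (auto simp: H_def Map.graph_def)
    then have "b \<in> B" by (simp add: H_def Map.graph_def iff adjoint_rel_iff)
    then obtain w u v where wuv: "b = w + v" "(w, u) \<in> G" "(u, v) \<in> H" using B1 by blast
    have "(y - u, w) \<in> H" using H(2)[OF yb wuv(3)] wuv(1) by simp
    then show "y \<in> {x + v | x u v. (x, u) \<in> H \<and> (u, v) \<in> G}"
      using wuv(2) by (intro CollectI exI[of _ "y - u"] exI[of _ w] exI[of _ u]) simp
  qed
  \<comment> \<open>The closed range lemma is used here with \<open>G\<close> and \<open>H\<close>
    exchanged, which is why it speaks of two sets of pairs and not of an operator and its
    adjoint.\<close>
  then have "closure (dom (op_adjoint B T)) \<subseteq> {x + v | x u v. (x, u) \<in> H \<and> (u, v) \<in> G}"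
    by (rule closure_minimal) (rule closed_range_one_plus_adjoint_comp[OF H G HG])
  then have "c \<in> {x + v | x u v. (x, u) \<in> H \<and> (u, v) \<in> G}"
    using c dense' unfolding densely_defined_on_def by blast
  then show thesis using that by (auto simp: G_def H_def Map.graph_def)
qed

section \<open>Biadjoints, module linearity and restriction to an essential ideal\<close>

lemma op_biadjoint_extends:
  assumes "densely_defined_on UNIV T" "densely_defined_on UNIV (op_adjoint UNIV T)"
  shows "T \<subseteq>\<^sub>m op_adjoint UNIV (op_adjoint UNIV T)"
proof -
  have "op_adjoint UNIV (op_adjoint UNIV T) x = Some y" if "T x = Some y" for x y
  proof -
    have "star x * b = star y * a" if "adjoint_rel UNIV T a b" for a b
    proof -
      have "star a * y = star b * x" using that \<open>T x = Some y\<close> by (simp add: adjoint_rel_iff)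
      from arg_cong[OF this, of star] show ?thesis by (simp add: star_mult star_star)
    qed
    then show ?thesis
      by (simp add: op_adjoint_eq_Some_iff[OF assms(2)] op_adjoint_eq_Some_iff[OF assms(1)]
          adjoint_rel_iff[of UNIV "op_adjoint UNIV T"])
  qed
  then show ?thesis by (auto simp: map_le_def dom_def)
qed

lemma densely_defined_on_map_le:
  assumes "densely_defined_on B T" "T \<subseteq>\<^sub>m R"
  shows "densely_defined_on B R"
  using assms closure_mono[OF map_le_implies_dom_le[OF assms(2)]]
  unfolding densely_defined_on_def by blast

text \<open>The definition of an operator asks only for complex linearity. Module linearity comes
  from the dense domain of the adjoint: every \<open>a\<close> in it satisfies
  \<open>star a * (z - y * b) = 0\<close>.\<close>

lemma semiregular_on_mult_right:
  assumes "semiregular_on UNIV S" and x: "S x = Some y"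
  shows "S (x * b) = Some (y * b)"
proof -
  have dense: "densely_defined_on UNIV S" and dense': "densely_defined_on UNIV (op_adjoint UNIV S)"
    and "x * b \<in> dom S"
    using assms by (auto simp: semiregular_on_def)
  then obtain z where z: "S (x * b) = Some z" by auto
  have "star (z - y * b) * a = 0 * a" if a: "a \<in> dom (op_adjoint UNIV S)" for a
  proof -
    obtain c where "op_adjoint UNIV S a = Some c" using a by auto
    then have "adjoint_rel UNIV S a c" by (simp add: op_adjoint_eq_Some_iff[OF dense])
    then have "star a * z = star c * (x * b)" "star a * y = star c * x"
      using x z by (auto simp: adjoint_rel_iff)
    then have "star a * (z - y * b) = 0"
      by (simp add: right_diff_distrib flip: mult.assoc)
    from arg_cong[OF this, of star] show ?thesis by (simp add: star_mult star_star)
  qed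
  then have "star (z - y * b) * (z - y * b) = 0 * (z - y * b)"
    using dense' left_mult_eq_on_dense[of "dom (op_adjoint UNIV S)" "star (z - y * b)" 0 UNIV]
    by (simp only: densely_defined_on_def UNIV_I)
  then have "z = y * b" by (simp add: star_mult_self_eq_0_iff)
  with z show ?thesis by simp
qed

text \<open>An \<open>x\<close> in the domain of \<open>S\<close> may lie outside \<open>K\<close>,
  but \<open>x * k\<close> lies inside. Testing there shows that
  \<open>star a * y - star b * x\<close> annihilates \<open>K\<close>, so it vanishes.\<close>

lemma adjoint_rel_restrict_ideal:
  assumes K: "essential_ideal K" and S: "semiregular_on UNIV S"
    and ab: "adjoint_rel K (S |` K) a b"
  shows "adjoint_rel UNIV S a b"
proof -
  have mult: "\<And>x a. x \<in> K \<Longrightarrow> a * x \<in> K"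
    using K by (auto simp: essential_ideal_def cstar_ideal_def)
  have "star a * y - star b * x = 0" if "S x = Some y" for x y
  proof (rule essential_ideal_annihilator[OF K])
    fix k assume "k \<in> K"
    then have "(S |` K) (x * k) = Some (y * k)"
      using semiregular_on_mult_right[OF S that] mult by simp
    then have "star a * (y * k) = star b * (x * k)"
      using ab by (simp add: adjoint_rel_iff)
    then show "(star a * y - star b * x) * k = 0" by (simp add: left_diff_distrib mult.assoc)
  qed
  then show ?thesis by (simp add: adjoint_rel_iff)
qed

text \<open>Modulo \<open>K\<close>, \<open>a\<close> is \<open>e * a\<close> and hence
  \<open>m * c * a\<close>, an element of \<open>M\<close>; the difference lies in \<open>K\<close>
  and is approximated from \<open>M\<close>.\<close>

lemma closure_plus_ideal_eq_UNIV:
  assumes M: "csubspace M" "\<And>x a. x \<in> M \<Longrightarrow> x * a \<in> M" "K \<subseteq> closure M"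
    and "cstar_ideal K" and e: "\<And>a. e * a - a \<in> K" and m: "m \<in> M" "m * c - e \<in> K"
  shows "closure M = UNIV"
proof -
  have V: "csubspace K" and mult: "\<And>x a. x \<in> K \<Longrightarrow> a * x \<in> K \<and> x * a \<in> K"
    using assms(4) by (auto simp: cstar_ideal_def)
  have "a \<in> closure M" for a
  proof -
    let ?k = "- (e * a - a) - (m * c - e) * a"
    have "?k \<in> K" using e m(2) V mult by (simp only: csubspace_diff csubspace_minus)
    then obtain s where s: "\<And>n::nat. s n \<in> M" "s \<longlonglongrightarrow> ?k"
      using M(3) closure_sequential by blast
    have "m * (c * a) \<in> M" using m(1) M(2) by blast
    then have "m * (c * a) + s n \<in> M" for n using M(1) s(1) csubspace_add by blast
    moreover have "(\<lambda>n. m * (c * a) + s n) \<longlonglongrightarrow> m * (c * a) + ?k"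
      by (intro tendsto_intros s)
    moreover have "m * (c * a) + ?k = a" by (simp add: algebra_simps)
    ultimately show ?thesis using closure_sequential by metis
  qed
  then show ?thesis by blast
qed

section \<open>Density of the range of \<open>1 + S\<^sup>*S\<close>\<close>

lemma semiregular_range_dense:
  fixes K :: "'a::cstar_algebra set"
  assumes essential: "essential_ideal K" and S: "semiregular_on UNIV S"
    and t: "regular_on K (S |` K)"
    and unit: "unital_on (quotient_carrier K) (quotient_mult K)"
  shows "closure {x + y | x y. (op_adjoint UNIV S \<circ>\<^sub>m S) x = Some y} = UNIV"
proof -
  have K: "cstar_ideal K" using essential by (simp add: essential_ideal_def)
  then have V: "csubspace K" and mult: "\<And>x a. x \<in> K \<Longrightarrow> a * x \<in> K" "\<And>x a. x \<in> K \<Longrightarrow> x * a \<in> K"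
    and closedK: "closed K"
    by (auto simp: cstar_ideal_def)
  have op: "operator_on UNIV S" and ideal: "\<And>x b. x \<in> dom S \<Longrightarrow> x * b \<in> dom S"
    and dense: "densely_defined_on UNIV S" and dense': "densely_defined_on UNIV (op_adjoint UNIV S)"
    using S by (auto simp: semiregular_on_def)
  note op' = operator_on_op_adjoint[OF dense csubspace_UNIV]
  note iff = op_adjoint_eq_Some_iff[OF dense csubspace_UNIV]
  have densek: "densely_defined_on K (S |` K)" using t by (simp add: regular_on_def)
  have adjk: "op_adjoint UNIV S a = Some b" if "op_adjoint K (S |` K) a = Some b" for a b
    using that adjoint_rel_restrict_ideal[OF essential S] op_adjoint_eq_Some_iff[OF densek V] iff
    by blast
  obtain e where e: "\<And>a. e * a - a \<in> K" "\<And>a. a * e - a \<in> K"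
    using quotient_unit_representative[OF V unit] by metis
  note Kstar = cstar_ideal_star_closed[OF K]
  note Kdiff = csubspace_diff[OF V] and Kadd = csubspace_add[OF V] and Kminus = csubspace_minus[OF V]
  \<comment> \<open>The unit of the quotient is self-adjoint: \<open>star e * e\<close> is congruent
    to both \<open>e\<close> and \<open>star e\<close>.\<close>
  have star_e: "star e - e \<in> K"
  proof -
    have "star e * e - star e \<in> K" by (rule e(2))
    moreover from Kstar[OF this] have "star e * e - e \<in> K" by (simp add: star_diff star_mult star_star)
    ultimately have "(star e * e - e) - (star e * e - star e) \<in> K" by (rule Kdiff[rotated])
    then show ?thesis by simp
  qed
  have adj_mult: "op_adjoint UNIV S (a * c) = Some (b * c)" if "op_adjoint UNIV S a = Some b" for a b c
    using that by (simp add: iff adjoint_rel_iff star_mult mult.assoc)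
  have "csubspace (dom S)" "closure (dom S) = UNIV"
    using op dense by (auto simp: operator_on_def densely_defined_on_def)
  then obtain x where x: "x \<in> dom S" "x - e \<in> K"
    using dense_right_ideal_meets_unit_coset[OF K e(1) _ ideal _ e(2)] by blast
  have "a * c \<in> dom (op_adjoint UNIV S)" if "a \<in> dom (op_adjoint UNIV S)" for a c
    using that adj_mult by blast
  moreover have "csubspace (dom (op_adjoint UNIV S))" "closure (dom (op_adjoint UNIV S)) = UNIV"
    using op' dense' by (auto simp: operator_on_def densely_defined_on_def)
  ultimately obtain y where y: "y \<in> dom (op_adjoint UNIV S)" "y - e \<in> K"
    using dense_right_ideal_meets_unit_coset[OF K e(1) _ _ _ e(2), of "dom (op_adjoint UNIV S)"]
    by blast
  obtain r where r: "S x = Some r" using x(1) by auto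
  obtain b where b: "op_adjoint UNIV S y = Some b" using y(1) by auto
  have yr: "star y * r = star b * x" using b r by (simp add: iff adjoint_rel_iff)
  define M where "M = {x + y | x y. (op_adjoint UNIV S \<circ>\<^sub>m S) x = Some y}"
  have M_iff: "z \<in> M \<longleftrightarrow> (\<exists>x u v. S x = Some u \<and> op_adjoint UNIV S u = Some v \<and> z = x + v)" for z
    by (auto simp: M_def map_comp_Some_iff)
  define c where "c = r - y * r"
  have "c = - (e * r - r) - (y - e) * r" by (simp add: c_def algebra_simps)
  then have "c \<in> K" using e(1) y(2) mult by (simp only: Kdiff Kminus)
  then obtain v w u where vwu: "op_adjoint K (S |` K) v = Some w" "(S |` K) w = Some u" "c = v + u"
    using regular_on_range_adjoint_comp[OF t V closedK] by metis
  have w: "S w = Some u" using vwu(2) by (auto simp: restrict_map_def split: if_splits)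
  \<comment> \<open>\<open>w\<close> is the correction \<open>t\<^sup>* v\<close>; from
    \<open>c = v + u\<close> it follows that \<open>r - u = y * r + v\<close>.\<close>
  have Sxw: "S (x - w) = Some (y * r + v)"
    using operator_on_graph_diff[OF op r w] vwu(3) by (simp add: c_def algebra_simps)
  have "op_adjoint UNIV S (y * r + v) = Some (b * r + w)"
  proof -
    have "adjoint_rel UNIV S (y * r) (b * r)" "adjoint_rel UNIV S v w"
      using adj_mult[OF b] adjk[OF vwu(1)] by (simp_all add: iff)
    then show ?thesis by (simp add: iff adjoint_rel_iff star_add distrib_right)
  qed
  \<comment> \<open>The correction \<open>w\<close> cancels in the sum.\<close>
  with Sxw have m: "x + b * r \<in> M" unfolding M_iff
    by (intro exI[of _ "x - w"] exI[of _ "y * r + v"] exI[of _ "b * r + w"]) simp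
  \<comment> \<open>Modulo \<open>K\<close>, \<open>star b\<close> is
    \<open>star b * x = star y * r\<close>, which is \<open>star e * r\<close> and so
    \<open>r\<close>.\<close>
  have "star b - r \<in> K"
  proof -
    have "star b - r = - (star b * e - star b) - star b * (x - e)
        + (star (y - e) * r + (star e - e) * r + (e * r - r))"
      using yr by (simp add: star_diff algebra_simps)
    then show ?thesis using e x(2) star_e Kstar[OF y(2)] mult
      by (simp only: Kdiff Kminus Kadd)
  qed
  from Kstar[OF this] have br: "b - star r \<in> K" by (simp add: star_diff star_star)
  \<comment> \<open>Modulo \<open>K\<close>, \<open>x + b * r\<close> is
    \<open>e + star r * r\<close>, and \<open>e + g\<close> is a right inverse of it because
    \<open>1 + g\<close> is one of \<open>1 + star r * r\<close>.\<close>
  obtain g where g: "g + star r * r + star r * r * g = 0"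
    using quasi_inverse_star_mult_self by metis
  have "(x + b * r) * (e + g) - e = (x - e) * (e + g) + (b - star r) * (r * (e + g))
      + (e * e - e) + (e * g - g) + ((star r * r) * e - star r * r) + (g + star r * r + star r * r * g)"
    by (simp add: algebra_simps)
  then have mc: "(x + b * r) * (e + g) - e \<in> K"
    using e x(2) br mult unfolding g by (simp only: Kadd add_0_right)
  have "csubspace M"
    unfolding csubspace_def
  proof (intro conjI ballI allI)
    show "0 \<in> M" unfolding M_iff
      using operator_on_graph_zero[OF op] operator_on_graph_zero[OF op'] by force
  next
    fix p q assume "p \<in> M" "q \<in> M"
    then obtain x u v x' u' v' where
      "S x = Some u" "op_adjoint UNIV S u = Some v" "p = x + v"
      "S x' = Some u'" "op_adjoint UNIV S u' = Some v'" "q = x' + v'"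
      unfolding M_iff by blast
    then show "p + q \<in> M" unfolding M_iff
      using operator_on_graph_add[OF op] operator_on_graph_add[OF op']
      by (intro exI[of _ "x + x'"] exI[of _ "u + u'"] exI[of _ "v + v'"]) (simp add: algebra_simps)
  next
    fix c p assume "p \<in> M"
    then obtain x u v where "S x = Some u" "op_adjoint UNIV S u = Some v" "p = x + v"
      unfolding M_iff by blast
    then show "c *\<^sub>C p \<in> M" unfolding M_iff
      using operator_on_graph_scaleC[OF op] operator_on_graph_scaleC[OF op']
      by (intro exI[of _ "c *\<^sub>C x"] exI[of _ "c *\<^sub>C u"] exI[of _ "c *\<^sub>C v"])
        (simp add: scaleC_add_right)
  qed
  moreover have "z * a \<in> M" if z: "z \<in> M" for z a
  proof -
    obtain x u v where "S x = Some u" "op_adjoint UNIV S u = Some v" "z = x + v"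
      using z unfolding M_iff by blast
    then show ?thesis unfolding M_iff using semiregular_on_mult_right[OF S] adj_mult
      by (intro exI[of _ "x * a"] exI[of _ "u * a"] exI[of _ "v * a"]) (simp add: distrib_right)
  qed
  moreover have "K \<subseteq> closure M"
  proof -
    have "{x + y | x y. (op_adjoint K (S |` K) \<circ>\<^sub>m (S |` K)) x = Some y} \<subseteq> M"
    proof
      fix z assume "z \<in> {x + y | x y. (op_adjoint K (S |` K) \<circ>\<^sub>m (S |` K)) x = Some y}"
      then obtain x u v where "z = x + v" "(S |` K) x = Some u" "op_adjoint K (S |` K) u = Some v"
        by (auto simp: map_comp_Some_iff)
      moreover from this(2) have "S x = Some u" by (auto simp: restrict_map_def split: if_splits)
      ultimately show "z \<in> M" using adjk unfolding M_iff by blast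
    qed
    then have "closure {x + y | x y. (op_adjoint K (S |` K) \<circ>\<^sub>m (S |` K)) x = Some y} \<subseteq> closure M"
      by (rule closure_mono)
    then show ?thesis using t unfolding regular_on_def by blast
  qed
  ultimately have "closure M = UNIV"
    using K e(1) m mc by (rule closure_plus_ideal_eq_UNIV)
  then show ?thesis by (simp add: M_def)
qed

theorem corollary3p3:
  fixes K :: "'a::cstar_algebra set" and S :: "'a \<rightharpoonup> 'a"
  assumes "separable_space (euclidean :: 'a topology)"
    and "\<not> unital_on (UNIV :: 'a set) (*)"
    and "essential_ideal K"
    and "semiregular_on UNIV S" and "closed_op S"
    and "regular_on K (S |` K)"
    and "unital_on (quotient_carrier K) (quotient_mult K)"
  shows "regular_on UNIV (op_adjoint UNIV (op_adjoint UNIV S))"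
proof -
  let ?A = "op_adjoint UNIV S"
  let ?R = "op_adjoint UNIV ?A"
  have S: "densely_defined_on UNIV S" and A: "densely_defined_on UNIV ?A"
    using assms(4) by (simp_all add: semiregular_on_def)
  \<comment> \<open>Since \<open>?R\<close> extends \<open>S\<close> and its adjoint extends
    \<open>?A\<close>, the range of \<open>1 + S\<^sup>*S\<close> lies in the corresponding range
    for \<open>?R\<close>, so density passes over.\<close>
  have SR: "S \<subseteq>\<^sub>m ?R" by (rule op_biadjoint_extends[OF S A])
  have R: "densely_defined_on UNIV ?R" by (rule densely_defined_on_map_le[OF S SR])
  have AR: "?A \<subseteq>\<^sub>m op_adjoint UNIV ?R" by (rule op_biadjoint_extends[OF A R])
  have "{x + y | x y. (?A \<circ>\<^sub>m S) x = Some y} \<subseteq> {x + y | x y. (op_adjoint UNIV ?R \<circ>\<^sub>m ?R) x = Some y}"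
  proof
    fix z assume "z \<in> {x + y | x y. (?A \<circ>\<^sub>m S) x = Some y}"
    then obtain x u v where z: "z = x + v" and "S x = Some u" "?A u = Some v"
      by (auto simp: map_comp_Some_iff)
    then have "?R x = Some u" "op_adjoint UNIV ?R u = Some v"
      using SR AR unfolding map_le_def by (metis domI)+
    then show "z \<in> {x + y | x y. (op_adjoint UNIV ?R \<circ>\<^sub>m ?R) x = Some y}"
      using z by (auto simp: map_comp_Some_iff)
  qed
  then have "UNIV \<subseteq> closure {x + y | x y. (op_adjoint UNIV ?R \<circ>\<^sub>m ?R) x = Some y}"
    using semiregular_range_dense[OF assms(3,4,6,7)] closure_mono by blast
  \<comment> \<open>The remaining conditions hold because \<open>?R\<close> is the adjoint of a
    densely defined operator, extends \<open>S\<close>, and has an adjoint extending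
    \<open>?A\<close>.\<close>
  then show ?thesis
    unfolding regular_on_def
    using operator_on_op_adjoint[OF A] closed_op_adjoint[OF A] R densely_defined_on_map_le[OF A AR]
    by simp
qed

end
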